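(* Let $n \geq 2$, let $X$ be an $n$-dimensional normed space (that is, $\mathbb{R}^n$ with a norm) with unit ball $B_X \subset \mathbb{R}^n$, and let $K \subset \mathbb{R}^n$ be a convex body. Assume that the dual space $X^*$ is $p$-uniformly convex with a constant $C>0$, for some $2 \leq p < \infty$. If $d(K, B_X) \geq (1-\varepsilon)n$ for some $0 \leq \varepsilon \leq \varepsilon_0$, then $$d(K, S_n) \leq 1 + C_0 \varepsilon^{\frac{1}{p+1}},$$ where $\varepsilon_0 = C\left(2 \cdot 40^{p+1} \cdot n^{5p+4}\right)^{-1}$ and $C_0 = 40n^3\left(\frac{2^{p+2} n^{2p+1}}{C}\right)^{\frac{1}{p+1}}$.
   Context: A convex body in $\mathbb{R}^n$ is a compact convex set with non-empty interior. $S_n$ denotes the regular simplex in $\mathbb{R}^n$. The Banach-Mazur distance of convex bodies $K, L \subset \mathbb{R}^n$ is $d(K,L) = \inf\{ r > 0 : K+u \subset T(L+v) \subset r(K+u)\}$, the infimum being over all invertible linear operators $T:\mathbb{R}^n\to\mathbb{R}^n$ and all $u,v\in\mathbb{R}^n$. For a normed space $Y$ with norm $\|\cdot\|$ and unit ball $B_Y$, the modulus of convexity is $\delta_Y(t) = \inf\left\{1 - \left\|\frac{x+y}{2}\right\| : x,y \in B_Y,\ \|x-y\| \geq t\right\}$ for $t \in [0,2]$. For $p \in [2,\infty)$, $Y$ is called $p$-uniformly convex with a constant $C$ if $\delta_Y(t) \geq C t^p$ for every $t \in [0,2]$. *)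

theory Defs
  imports "HOL-Analysis.Analysis"
begin

definition convex_body :: "'a::euclidean_space set \<Rightarrow> bool" where
  "convex_body K \<longleftrightarrow> compact K \<and> convex K \<and> interior K \<noteq> {}"

definition regular_simplex :: "'a::euclidean_space set \<Rightarrow> bool" where
  "regular_simplex S \<longleftrightarrow>
     (\<exists>V. card V = DIM('a) + 1 \<and> \<not> affine_dependent V \<and> S = convex hull V \<and>
          (\<exists>a. \<forall>x\<in>V. \<forall>y\<in>V. x \<noteq> y \<longrightarrow> dist x y = a))"

definition banach_mazur :: "'a::real_vector set \<Rightarrow> 'a set \<Rightarrow> real" where
  "banach_mazur K L =
     Inf {r. r > 0 \<and>
       (\<exists>T u v. linear T \<and> bij T \<and>
          (\<lambda>x. x + u) ` K \<subseteq> T ` ((\<lambda>x. x + v) ` L) \<and>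
          T ` ((\<lambda>x. x + v) ` L) \<subseteq> (\<lambda>x. r *\<^sub>R x) ` ((\<lambda>x. x + u) ` K))}"

text \<open>
  An \<open>n\<close>-dimensional normed space \<open>X\<close> is given by an arbitrary norm \<open>N\<close> on the vector space
  \<open>real ^ 'n\<close>; it is unrelated to the Euclidean norm that this type carries as a type class
  instance.
\<close>

definition is_norm :: "('a::real_vector \<Rightarrow> real) \<Rightarrow> bool" where
  "is_norm N \<longleftrightarrow>
     (\<forall>x. N x = 0 \<longleftrightarrow> x = 0) \<and>
     (\<forall>c x. N (c *\<^sub>R x) = \<bar>c\<bar> * N x) \<and>
     (\<forall>x y. N (x + y) \<le> N x + N y)"

definition unit_ball :: "('a::real_vector \<Rightarrow> real) \<Rightarrow> 'a set" where
  "unit_ball N = {x. N x \<le> 1}"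

text \<open>
  In finite dimension every linear functional is continuous, whatever the norm, so the type
  \<open>'a \<Rightarrow>\<^sub>L real\<close> is, as a vector space, the dual of \<open>'a\<close> equipped with \<open>N\<close>. Only its vector space
  structure is used: its own norm (dual to the Euclidean one) is replaced by the norm dual to \<open>N\<close>.
\<close>

definition dual_norm :: "('a::euclidean_space \<Rightarrow> real) \<Rightarrow> ('a \<Rightarrow>\<^sub>L real) \<Rightarrow> real" where
  "dual_norm N f = (SUP x\<in>unit_ball N. \<bar>blinfun_apply f x\<bar>)"

definition modulus_of_convexity :: "('a::real_vector \<Rightarrow> real) \<Rightarrow> real \<Rightarrow> real" where
  "modulus_of_convexity N t =
     Inf {1 - N ((1/2) *\<^sub>R (x + y)) | x y. x \<in> unit_ball N \<and> y \<in> unit_ball N \<and> N (x - y) \<ge> t}"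

definition uniformly_convex :: "real \<Rightarrow> real \<Rightarrow> ('a::real_vector \<Rightarrow> real) \<Rightarrow> bool" where
  "uniformly_convex p C N \<longleftrightarrow> (\<forall>t\<in>{0..2}. modulus_of_convexity N t \<ge> C * t powr p)"

end

theory Submission
  imports Defs
begin

text \<open>
  In John position, that is, after an affine change of \<open>K\<close> that maximises volume, \<open>K\<close> lies in the unit
  ball \<open>L\<close> of the norm and there are points \<open>x i\<close> of \<open>K\<close>, functionals \<open>y i\<close> of norm at most one and
  weights \<open>P i\<close> with sum one such that the \<open>y i\<close> average to zero and
  \<open>u = n * (\<Sum>i. P i * y i(u) * x i)\<close> for every vector \<open>u\<close> (\<open>john_position\<close>). Since
  \<open>1 + y i(u) \<ge> 0\<close> for \<open>u\<close> in \<open>L\<close>, this formula writes \<open>L\<close> inside a translate of \<open>n K\<close>, so the distance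
  is at most \<open>n\<close>; the theorem asks what follows when nothing is wasted in this argument.

  If the distance is almost \<open>n\<close>, no translate of \<open>r K\<close> with \<open>r\<close> slightly below \<open>n\<close> covers \<open>L\<close>. By
  Helly's theorem and separation (\<open>noncovering_functionals\<close>) this has a certificate: \<open>n + 1\<close> affine
  functions \<open>g j\<close>, nonnegative on \<open>K\<close> with sum one, and \<open>n + 1\<close> points \<open>v j\<close> of \<open>L\<close>. The \<open>g j\<close> are
  barycentric coordinates of a simplex containing \<open>K\<close>, and it remains to see that \<open>K\<close> nearly contains
  the vertices of that simplex. Read \<open>g j(x i)\<close> as the probability that \<open>x i\<close> is given the label \<open>j\<close>.
  The certificate, expanded along the decomposition of the identity, says that for a random
  pair \<open>(i, j)\<close> the functional \<open>y i\<close> nearly attains the value one at \<open>- v j\<close>.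

  Uniform convexity of the dual norm now makes the functionals with a given label \<open>j\<close> cluster around
  their mean \<open>\<eta> j\<close>. The identity is then close to a combination of rank-one maps built from the \<open>n + 1\<close>
  functionals \<open>\<eta> j\<close>, which satisfy one linear relation; were two of them close to each other, its rank
  would in effect drop below \<open>n\<close> (\<open>\<eta>_separated\<close>). As distinct clusters are apart, almost every \<open>x i\<close>
  has an almost deterministic label, and the mean of the points with label \<open>k\<close> satisfies \<open>g k \<approx> 1\<close>
  (\<open>almost_vertex\<close>). So \<open>K\<close> lies between a simplex and a slightly smaller homothetic copy of it
  (\<open>simplex_sandwich\<close>). With \<open>\<beta> = (\<epsilon> / C) powr (1 / (p + 1))\<close> the mean distance to the cluster centres
  is at most \<open>2 \<beta>\<close> (\<open>D_le\<close>), and the resulting bound \<open>1 + 48 n^2 \<beta>\<close> is below the asserted one.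
\<close>

section \<open>Upper bounds on the Banach-Mazur distance\<close>

text \<open>
  The distance allows separate translations of \<open>K\<close> and \<open>L\<close>, but demands that both inclusions be
  scaled about the origin. Since \<open>r \<noteq> 1\<close>, the homothety carrying the inner copy of \<open>K\<close> to the outer
  one has a centre, and moving it to the origin turns any affine sandwich into an admissible one.
\<close>

lemma banach_mazur_le:
  assumes lin: "linear \<phi>" and bij: "bij \<phi>" and r: "r > 1"
    and inner: "\<And>x. x \<in> K \<Longrightarrow> \<phi> x + c \<in> L"
    and outer: "\<And>s. s \<in> L \<Longrightarrow> \<exists>x\<in>K. s = r *\<^sub>R \<phi> x + w"
  shows "banach_mazur K L \<le> r"
proof -
  define T where "T = inv \<phi>"
  define v where "v = (1 / (r - 1)) *\<^sub>R (w - r *\<^sub>R c)"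
  define u where "u = T (c + v)"
  have T\<phi>: "T (\<phi> x) = x" for x unfolding T_def using bij by (simp add: bij_is_inj)
  have linT: "linear T"
  proof (rule linearI)
    fix x y and k :: real
    obtain a b where ab: "x = \<phi> a" "y = \<phi> b" using bij by (metis bij_pointE)
    show "T (x + y) = T x + T y"
      unfolding ab linear_add[OF lin, symmetric] by (simp add: T\<phi>)
    show "T (k *\<^sub>R x) = k *\<^sub>R T x"
      unfolding ab linear_scale[OF lin, symmetric] by (simp add: T\<phi>)
  qed
  have bijT: "bij T" unfolding T_def using bij by (rule bij_imp_bij_inv)
  have "(r - 1) *\<^sub>R v = w - r *\<^sub>R c" unfolding v_def using r by simp
  \<comment> \<open>the translation \<open>v\<close> makes the centres of the inner and of the outer copy coincide\<close>
  then have vw: "w + v = r *\<^sub>R (c + v)"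
    by (simp add: algebra_simps)
  have 1: "(\<lambda>x. x + u) ` K \<subseteq> T ` ((\<lambda>x. x + v) ` L)"
  proof clarify
    fix x assume "x \<in> K"
    then have "\<phi> x + c \<in> L" by (rule inner)
    moreover have "x + u = T ((\<phi> x + c) + v)"
      unfolding u_def by (simp add: linear_add[OF linT] T\<phi> add.assoc)
    ultimately show "x + u \<in> T ` ((\<lambda>x. x + v) ` L)" by blast
  qed
  have 2: "T ` ((\<lambda>x. x + v) ` L) \<subseteq> (\<lambda>x. r *\<^sub>R x) ` ((\<lambda>x. x + u) ` K)"
  proof clarify
    fix s assume "s \<in> L"
    then obtain x where x: "x \<in> K" "s = r *\<^sub>R \<phi> x + w" using outer by blast
    have "T (s + v) = T (r *\<^sub>R \<phi> x + (w + v))" by (simp add: x(2) add.assoc)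
    also have "\<dots> = r *\<^sub>R (x + u)"
      unfolding vw u_def by (simp add: linear_add[OF linT] linear_scale[OF linT] T\<phi> algebra_simps)
    finally show "T (s + v) \<in> (\<lambda>x. r *\<^sub>R x) ` ((\<lambda>x. x + u) ` K)" using x(1) by blast
  qed
  show ?thesis unfolding banach_mazur_def
  proof (rule cInf_lower)
    show "r \<in> {r. r > 0 \<and> (\<exists>T u v. linear T \<and> bij T \<and>
          (\<lambda>x. x + u) ` K \<subseteq> T ` ((\<lambda>x. x + v) ` L) \<and>
          T ` ((\<lambda>x. x + v) ` L) \<subseteq> (\<lambda>x. r *\<^sub>R x) ` ((\<lambda>x. x + u) ` K))}"
      using r linT bijT 1 2 by auto
    show "bdd_below {r. r > 0 \<and> (\<exists>T u v. linear T \<and> bij T \<and>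
          (\<lambda>x. x + u) ` K \<subseteq> T ` ((\<lambda>x. x + v) ` L) \<and>
          T ` ((\<lambda>x. x + v) ` L) \<subseteq> (\<lambda>x. r *\<^sub>R x) ` ((\<lambda>x. x + u) ` K))}"
      by (rule bdd_belowI[where m = 0]) auto
  qed
qed

lemma convex_body_affine_image:
  fixes K :: "'a::euclidean_space set" and \<psi> :: "'a \<Rightarrow> 'a"
  assumes K: "convex_body K" and \<psi>: "linear \<psi>" "bij \<psi>"
  shows "convex_body ((\<lambda>a. \<psi> a + c) ` K)"
proof -
  have eq: "(\<lambda>a. \<psi> a + c) ` K = (+) c ` \<psi> ` K" by (auto simp: image_iff add.commute)
  have "interior (\<psi> ` K) = \<psi> ` interior K"
    using \<psi> by (intro interior_injective_linear_image) (auto simp: bij_is_inj)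
  then show ?thesis
    using K \<psi>(1) unfolding convex_body_def eq
    by (auto simp: interior_translation intro!: compact_translation convex_translation convex_linear_image
        compact_continuous_image linear_continuous_on simp: linear_conv_bounded_linear)
qed

section \<open>Norms on a Euclidean space and their duals\<close>

lemma is_norm_simps:
  assumes "is_norm N"
  shows "N 0 = 0" "N (- x) = N x" "N (c *\<^sub>R x) = \<bar>c\<bar> * N x" "N (x + y) \<le> N x + N y" "N x \<ge> 0"
proof -
  show *: "N 0 = 0" "N (c *\<^sub>R x) = \<bar>c\<bar> * N x" "N (x + y) \<le> N x + N y" for c x y
    using assms unfolding is_norm_def by auto
  show neg: "N (- x) = N x" for x using *(2)[of "-1" x] by simp
  show "N x \<ge> 0" using *(3)[of x "- x"] neg[of x] *(1) by simp
qed

lemma is_norm_pos: "is_norm N \<Longrightarrow> x \<noteq> 0 \<Longrightarrow> N x > 0"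
  by (metis is_norm_def is_norm_simps(5) less_eq_real_def)

lemma is_norm_sum:
  assumes "is_norm N"
  shows "N (\<Sum>i\<in>I. f i) \<le> (\<Sum>i\<in>I. N (f i))"
proof (induction I rule: infinite_finite_induct)
  case (insert i I)
  then show ?case using is_norm_simps(4)[OF assms, of "f i" "sum f I"] by simp
qed (auto simp: is_norm_simps[OF assms])

lemma is_norm_continuous:
  fixes N :: "'a::euclidean_space \<Rightarrow> real"
  assumes "is_norm N"
  shows "continuous_on S N"
proof -
  have "convex_on UNIV N"
  proof (rule convex_onI)
    fix t :: real and x y :: 'a assume "0 < t" "t < 1"
    then show "N ((1 - t) *\<^sub>R x + t *\<^sub>R y) \<le> (1 - t) * N x + t * N y"
      using is_norm_simps(4)[OF assms, of "(1 - t) *\<^sub>R x" "t *\<^sub>R y"]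
      by (simp add: is_norm_simps(3)[OF assms])
  qed auto
  then have "continuous_on UNIV N" by (intro convex_on_continuous) auto
  then show ?thesis by (rule continuous_on_subset) auto
qed

lemma is_norm_equivalent_to_norm:
  fixes N :: "'a::euclidean_space \<Rightarrow> real"
  assumes "is_norm N"
  obtains c M where "c > 0" "M > 0" "\<And>x. c * norm x \<le> N x" "\<And>x. N x \<le> M * norm x"
proof -
  let ?S = "sphere (0::'a) 1"
  have ne: "?S \<noteq> {}" by simp
  have co: "continuous_on ?S N" by (rule is_norm_continuous[OF assms])
  obtain a where a: "a \<in> ?S" "\<And>x. x \<in> ?S \<Longrightarrow> N a \<le> N x"
    using continuous_attains_inf[OF compact_sphere ne co] by auto
  obtain b where b: "b \<in> ?S" "\<And>x. x \<in> ?S \<Longrightarrow> N x \<le> N b"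
    using continuous_attains_sup[OF compact_sphere ne co] by auto
  have scale: "N x = norm x * N (x /\<^sub>R norm x)" if "x \<noteq> 0" for x
    using that by (simp add: is_norm_simps(3)[OF assms])
  have "N a > 0" using a(1) by (intro is_norm_pos[OF assms]) auto
  moreover have "N b > 0" using b(1) by (intro is_norm_pos[OF assms]) auto
  moreover have "N a * norm x \<le> N x" for x
  proof (cases "x = 0")
    case False
    then have "N a \<le> N (x /\<^sub>R norm x)" by (intro a(2)) simp
    then show ?thesis using scale[OF False] by (metis mult.commute mult_left_mono norm_ge_zero)
  qed (simp add: is_norm_simps[OF assms])
  moreover have "N x \<le> N b * norm x" for x
  proof (cases "x = 0")
    case False
    then have "N (x /\<^sub>R norm x) \<le> N b" by (intro b(2)) simp
    then show ?thesis using scale[OF False] by (metis mult.commute mult_left_mono norm_ge_zero)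
  qed (simp add: is_norm_simps[OF assms])
  ultimately show ?thesis using that by blast
qed

lemma compact_unit_ball:
  fixes N :: "'a::euclidean_space \<Rightarrow> real"
  assumes "is_norm N"
  shows "compact (unit_ball N)"
proof -
  obtain c M where c: "c > 0" "\<And>x. c * norm x \<le> N x" using is_norm_equivalent_to_norm[OF assms] by metis
  have "norm x \<le> 1 / c" if "N x \<le> 1" for x
    using c(1) c(2)[of x] that by (simp add: field_simps)
  then have "bounded (unit_ball N)" unfolding bounded_iff unit_ball_def by blast
  moreover have "closed (unit_ball N)" unfolding unit_ball_def
    by (intro closed_Collect_le is_norm_continuous[OF assms] continuous_on_const)
  ultimately show ?thesis by (simp add: compact_eq_bounded_closed)
qed

lemma convex_unit_ball:
  assumes "is_norm N"
  shows "convex (unit_ball N)"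
proof (rule convexI)
  fix x y u v assume a: "x \<in> unit_ball N" "y \<in> unit_ball N" "0 \<le> (u::real)" "0 \<le> v" "u + v = 1"
  have "N (u *\<^sub>R x + v *\<^sub>R y) \<le> u * N x + v * N y"
    using is_norm_simps(4)[OF assms, of "u *\<^sub>R x" "v *\<^sub>R y"] a by (simp add: is_norm_simps(3)[OF assms])
  also have "\<dots> \<le> u * 1 + v * 1" using a by (intro add_mono mult_left_mono) (auto simp: unit_ball_def)
  finally show "u *\<^sub>R x + v *\<^sub>R y \<in> unit_ball N" using a by (simp add: unit_ball_def)
qed

definition polar_ball :: "('a::euclidean_space \<Rightarrow> real) \<Rightarrow> 'a set" where
  "polar_ball N = {y. \<forall>x\<in>unit_ball N. y \<bullet> x \<le> 1}"

text \<open>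
  Functionals are represented by vectors through the inner product, which makes the polar ball a
  subset of the space that carries \<open>N\<close>.
\<close>

abbreviation inner_dual_norm :: "('a::euclidean_space \<Rightarrow> real) \<Rightarrow> 'a \<Rightarrow> real" where
  "inner_dual_norm N y \<equiv> dual_norm N (blinfun_inner_right y)"

lemma polar_ball_abs_le:
  assumes N: "is_norm N" and y: "y \<in> polar_ball N"
  shows "\<bar>y \<bullet> x\<bar> \<le> N x"
proof (cases "x = 0")
  case False
  then have pos: "N x > 0" by (rule is_norm_pos[OF N])
  have "N (x /\<^sub>R N x) = 1" using pos by (simp add: is_norm_simps(3)[OF N])
  then have "x /\<^sub>R N x \<in> unit_ball N" "- (x /\<^sub>R N x) \<in> unit_ball N"
    by (simp_all add: unit_ball_def is_norm_simps(2)[OF N])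
  then have "y \<bullet> (x /\<^sub>R N x) \<le> 1" "y \<bullet> (- (x /\<^sub>R N x)) \<le> 1" using y unfolding polar_ball_def by blast+
  then show ?thesis using pos by (simp add: field_simps abs_le_iff)
qed (simp add: is_norm_simps[OF N])

lemma convex_polar_ball: "convex (polar_ball N)"
proof -
  have "polar_ball N = (\<Inter>x\<in>unit_ball N. {y. x \<bullet> y \<le> 1})"
    by (auto simp: polar_ball_def inner_commute)
  then show ?thesis by (auto intro: convex_INT convex_halfspace_le)
qed

lemma compact_polar_ball:
  assumes N: "is_norm N"
  shows "compact (polar_ball N)"
proof -
  have "polar_ball N = (\<Inter>x\<in>unit_ball N. {y. x \<bullet> y \<le> 1})"
    by (auto simp: polar_ball_def inner_commute)
  then have "closed (polar_ball N)" by (auto intro: closed_INT closed_halfspace_le)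
  moreover obtain c M where M: "M > 0" "\<And>x. N x \<le> M * norm x" using is_norm_equivalent_to_norm[OF N] by metis
  have "norm y \<le> M" if "y \<in> polar_ball N" for y
  proof (cases "y = 0")
    case False
    have "norm y * norm y = y \<bullet> y" by (simp add: dot_square_norm power2_eq_square)
    also have "\<dots> \<le> M * norm y" using polar_ball_abs_le[OF N that, of y] M(2)[of y] by linarith
    finally show ?thesis using False by simp
  qed (use M in simp)
  then have "bounded (polar_ball N)" unfolding bounded_iff by blast
  ultimately show ?thesis by (simp add: compact_eq_bounded_closed)
qed

lemma polar_ball_contains_ball:
  assumes N: "is_norm N"
  obtains \<delta> where "\<delta> > 0" "\<And>y. norm y \<le> \<delta> \<Longrightarrow> y \<in> polar_ball N"
proof -
  obtain c M where c: "c > 0" "\<And>x. c * norm x \<le> N x" using is_norm_equivalent_to_norm[OF N] by metis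
  have "y \<in> polar_ball N" if "norm y \<le> c" for y
    unfolding polar_ball_def unit_ball_def
  proof clarify
    fix x assume "N x \<le> 1"
    have "y \<bullet> x \<le> norm y * norm x" by (rule norm_cauchy_schwarz)
    also have "\<dots> \<le> c * norm x" using that by (intro mult_right_mono) auto
    also have "\<dots> \<le> 1" using c(2)[of x] \<open>N x \<le> 1\<close> by linarith
    finally show "y \<bullet> x \<le> 1" .
  qed
  then show ?thesis using that c(1) by blast
qed

lemma bipolar:
  assumes N: "is_norm N" and x: "\<And>y. y \<in> polar_ball N \<Longrightarrow> y \<bullet> x \<le> 1"
  shows "x \<in> unit_ball N"
proof (rule ccontr)
  assume "x \<notin> unit_ball N"
  then obtain a b where ab: "a \<bullet> x < b" "\<And>z. z \<in> unit_ball N \<Longrightarrow> a \<bullet> z > b"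
    using separating_hyperplane_closed_point[OF convex_unit_ball[OF N] compact_imp_closed[OF compact_unit_ball[OF N]]]
    by metis
  have "b < 0" using ab(2)[of 0] by (simp add: unit_ball_def is_norm_simps[OF N])
  have "(1/b) *\<^sub>R a \<in> polar_ball N" unfolding polar_ball_def
    using ab(2) \<open>b < 0\<close> by (auto simp: field_simps intro: less_imp_le)
  from x[OF this] show False using ab(1) \<open>b < 0\<close> by (auto simp: field_simps)
qed

lemma inner_dual_norm_upper:
  assumes N: "is_norm N"
  shows "\<bar>y \<bullet> x\<bar> \<le> inner_dual_norm N y * N x"
proof -
  have bdd: "bdd_above ((\<lambda>x. \<bar>y \<bullet> x\<bar>) ` unit_ball N)"
    by (intro bounded_imp_bdd_above compact_imp_bounded compact_continuous_image
        compact_unit_ball[OF N] continuous_intros)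
  have *: "\<bar>y \<bullet> x\<bar> \<le> inner_dual_norm N y" if "N x \<le> 1" for x
    unfolding dual_norm_def using cSUP_upper[OF _ bdd, of x] that by (simp add: unit_ball_def)
  show ?thesis
  proof (cases "x = 0")
    case False
    then have pos: "N x > 0" by (rule is_norm_pos[OF N])
    have "N (x /\<^sub>R N x) = 1" using pos by (simp add: is_norm_simps(3)[OF N])
    then have "\<bar>y \<bullet> (x /\<^sub>R N x)\<bar> \<le> inner_dual_norm N y" by (intro *) simp
    then show ?thesis using pos by (simp add: field_simps abs_mult)
  qed (simp add: is_norm_simps[OF N])
qed

lemma inner_dual_norm_least:
  assumes N: "is_norm N" and "\<And>x. N x \<le> 1 \<Longrightarrow> \<bar>y \<bullet> x\<bar> \<le> c"
  shows "inner_dual_norm N y \<le> c"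
proof -
  have "(0::'a) \<in> unit_ball N" by (simp add: unit_ball_def is_norm_simps[OF N])
  then have "unit_ball N \<noteq> {}" by blast
  then show ?thesis unfolding dual_norm_def
    using assms(2) by (intro cSUP_least) (auto simp: unit_ball_def)
qed

lemma inner_dual_norm_nonneg:
  assumes N: "is_norm N"
  shows "0 \<le> inner_dual_norm N y"
proof -
  obtain b :: 'a where "b \<in> Basis" using nonempty_Basis by blast
  then have "b \<noteq> 0" by auto
  then have "N b > 0" by (rule is_norm_pos[OF N])
  moreover have "0 \<le> inner_dual_norm N y * N b"
    using inner_dual_norm_upper[OF N, of y b] by linarith
  ultimately show ?thesis by (simp add: zero_le_mult_iff)
qed

text \<open>
  The triangle inequality through a third functional \<open>c\<close>, in the form in which a contact functional
  near two cluster centres forces these centres to be near each other.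
\<close>

lemma inner_dual_norm_diff_triangle:
  assumes N: "is_norm N"
  shows "inner_dual_norm N (a - b) \<le> inner_dual_norm N (c - a) + inner_dual_norm N (c - b)"
proof (rule inner_dual_norm_least[OF N])
  fix x assume x: "N x \<le> 1"
  have *: "\<bar>z \<bullet> x\<bar> \<le> inner_dual_norm N z" for z
    using inner_dual_norm_upper[OF N, of z x] mult_left_le[OF x inner_dual_norm_nonneg[OF N, of z]] by linarith
  have "(a - b) \<bullet> x = (c - b) \<bullet> x - (c - a) \<bullet> x" by (simp add: inner_diff_left)
  then show "\<bar>(a - b) \<bullet> x\<bar> \<le> inner_dual_norm N (c - a) + inner_dual_norm N (c - b)"
    using *[of "c - a"] *[of "c - b"] by linarith
qed

lemma inner_dual_norm_le_1:
  assumes N: "is_norm N" and y: "y \<in> polar_ball N"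
  shows "inner_dual_norm N y \<le> 1"
  using polar_ball_abs_le[OF N y] by (intro inner_dual_norm_least[OF N]) (meson order_trans)

lemma blinfun_inner_right_add: "blinfun_inner_right x + blinfun_inner_right y = blinfun_inner_right (x + y)"
  and blinfun_inner_right_diff: "blinfun_inner_right x - blinfun_inner_right y = blinfun_inner_right (x - y)"
  and blinfun_inner_right_scale: "c *\<^sub>R blinfun_inner_right x = blinfun_inner_right (c *\<^sub>R x)"
  by (auto intro!: blinfun_eqI simp: plus_blinfun.rep_eq minus_blinfun.rep_eq scaleR_blinfun.rep_eq
      inner_add_left inner_diff_left)

text \<open>
  Uniform convexity in the form used for clustering: functionals that nearly attain their norm at a
  common point \<open>v\<close> have a midpoint of norm close to one, hence are close to each other.
\<close>

lemma uniform_convexity_slice: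
  assumes N: "is_norm N" and uc: "uniformly_convex p C (dual_norm N)"
    and y: "y \<in> polar_ball N" and z: "z \<in> polar_ball N" and v: "v \<in> unit_ball N"
  shows "C * inner_dual_norm N (y - z) powr p \<le> ((1 - y \<bullet> v) + (1 - z \<bullet> v)) / 2"
proof -
  define t where "t = inner_dual_norm N (y - z)"
  define \<Delta> where "\<Delta> = {1 - dual_norm N ((1/2) *\<^sub>R (f + g)) | f g.
      f \<in> unit_ball (dual_norm N) \<and> g \<in> unit_ball (dual_norm N) \<and> dual_norm N (f - g) \<ge> t}"
  have v1: "N v \<le> 1" using v by (simp add: unit_ball_def)
  have t0: "0 \<le> t" unfolding t_def by (rule inner_dual_norm_nonneg[OF N])
  have t2: "t \<le> 2" unfolding t_def
  proof (rule inner_dual_norm_least[OF N])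
    fix x assume "N x \<le> 1"
    then show "\<bar>(y - z) \<bullet> x\<bar> \<le> 2"
      using polar_ball_abs_le[OF N y, of x] polar_ball_abs_le[OF N z, of x] by (simp add: inner_diff_left)
  qed
  have surj: "\<exists>y. f = blinfun_inner_right y" for f :: "'a \<Rightarrow>\<^sub>L real"
  proof
    show "f = blinfun_inner_right (adjoint (blinfun_apply f) 1)"
    proof (rule blinfun_eqI)
      fix x
      have "linear (blinfun_apply f)" by (rule bounded_linear.linear[OF blinfun.bounded_linear_right])
      from adjoint_works[OF this, of x 1] show "blinfun_apply f x = blinfun_apply (blinfun_inner_right (adjoint (blinfun_apply f) 1)) x"
        by (simp add: inner_commute)
    qed
  qed
  have half: "dual_norm N ((1/2) *\<^sub>R (f + g)) \<le> 1" if fg: "dual_norm N f \<le> 1" "dual_norm N g \<le> 1" for f g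
  proof -
    obtain a b where ab: "f = blinfun_inner_right a" "g = blinfun_inner_right b" using surj by metis
    have "\<bar>((1/2) *\<^sub>R (a + b)) \<bullet> x\<bar> \<le> 1" if "N x \<le> 1" for x
    proof -
      have "\<bar>a \<bullet> x\<bar> \<le> 1" "\<bar>b \<bullet> x\<bar> \<le> 1"
        using inner_dual_norm_upper[OF N, of a x] inner_dual_norm_upper[OF N, of b x] fg
          mult_mono[OF fg(1) that] mult_mono[OF fg(2) that] is_norm_simps(5)[OF N] unfolding ab by fastforce+
      then show ?thesis by (simp add: inner_add_left)
    qed
    then show ?thesis unfolding ab by (simp add: blinfun_inner_right_add blinfun_inner_right_scale inner_dual_norm_least[OF N])
  qed
  have bdd: "bdd_below \<Delta>"
    by (rule bdd_belowI[where m = 0]) (use half in \<open>auto simp: \<Delta>_def unit_ball_def\<close>)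
  have mem: "1 - inner_dual_norm N ((1/2) *\<^sub>R (y + z)) \<in> \<Delta>"
    unfolding \<Delta>_def unit_ball_def t_def
    by (simp, rule exI[of _ "blinfun_inner_right y"], rule exI[of _ "blinfun_inner_right z"])
      (auto simp: blinfun_inner_right_add blinfun_inner_right_diff blinfun_inner_right_scale
        inner_dual_norm_le_1[OF N y] inner_dual_norm_le_1[OF N z])
  have "C * t powr p \<le> modulus_of_convexity (dual_norm N) t"
    using uc t0 t2 by (simp add: uniformly_convex_def)
  also have "\<dots> \<le> 1 - inner_dual_norm N ((1/2) *\<^sub>R (y + z))"
    unfolding modulus_of_convexity_def \<Delta>_def[symmetric] by (rule cInf_lower[OF mem bdd])
  also have "\<dots> \<le> 1 - ((1/2) *\<^sub>R (y + z)) \<bullet> v"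
  proof -
    have "((1/2) *\<^sub>R (y + z)) \<bullet> v \<le> inner_dual_norm N ((1/2) *\<^sub>R (y + z)) * N v"
      using inner_dual_norm_upper[OF N, of "(1/2) *\<^sub>R (y + z)" v] by linarith
    also have "\<dots> \<le> inner_dual_norm N ((1/2) *\<^sub>R (y + z))"
      by (rule mult_left_le[OF v1 inner_dual_norm_nonneg[OF N]])
    finally show ?thesis by simp
  qed
  also have "\<dots> = ((1 - y \<bullet> v) + (1 - z \<bullet> v)) / 2" by (simp add: inner_add_left field_simps)
  finally show ?thesis unfolding t_def .
qed

text \<open>
  An a priori bound on \<open>C\<close>: it makes \<open>C * \<beta> powr (p + 1)\<close> small whenever \<open>\<beta>\<close> is.
\<close>

lemma uniformly_convex_constant_le_1:
  fixes N :: "'a::euclidean_space \<Rightarrow> real"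
  assumes N: "is_norm N" and uc: "uniformly_convex p C (dual_norm N)" and p: "p \<ge> 0" and C: "C > 0"
  shows "C \<le> 1"
proof -
  obtain b :: 'a where b: "b \<in> Basis" using nonempty_Basis by blast
  define s where "s = inner_dual_norm N b"
  have up: "\<bar>b \<bullet> x\<bar> \<le> s * N x" for x unfolding s_def by (rule inner_dual_norm_upper[OF N])
  have s: "s > 0" using up[of b] b is_norm_simps(5)[OF N, of b] inner_dual_norm_nonneg[OF N, of b]
    by (cases "s = 0") (auto simp: s_def)
  define y where "y = (1 / s) *\<^sub>R b"
  have y: "y \<in> polar_ball N" "- y \<in> polar_ball N"
  proof -
    have "\<bar>y \<bullet> x\<bar> \<le> 1" if "N x \<le> 1" for x
    proof -
      have "\<bar>b \<bullet> x\<bar> \<le> s" using up[of x] mult_left_le[OF that less_imp_le[OF s]] by linarith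
      then show ?thesis using s by (simp add: y_def abs_mult)
    qed
    then show "y \<in> polar_ball N" "- y \<in> polar_ball N" by (force simp: polar_ball_def unit_ball_def abs_le_iff)+
  qed
  \<comment> \<open>\<open>y\<close> and \<open>- y\<close> are unit functionals at distance two, which is more than enough\<close>
  have one: "1 \<le> inner_dual_norm N (y - (- y))"
  proof -
    have "s \<le> s * inner_dual_norm N (y - (- y))"
      unfolding s_def
    proof (rule inner_dual_norm_least[OF N], fold s_def)
      fix x assume x: "N x \<le> 1"
      have "\<bar>b \<bullet> x\<bar> \<le> s * \<bar>(y - (- y)) \<bullet> x\<bar>" using s by (simp add: y_def abs_mult inner_add_left)
      also have "\<dots> \<le> s * (inner_dual_norm N (y - (- y)) * N x)"
        using s by (intro mult_left_mono inner_dual_norm_upper[OF N]) auto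
      also have "\<dots> \<le> s * inner_dual_norm N (y - (- y))"
        using s by (intro mult_left_mono mult_left_le[OF x] inner_dual_norm_nonneg[OF N]) auto
      finally show "\<bar>b \<bullet> x\<bar> \<le> s * inner_dual_norm N (y - (- y))" .
    qed
    then show ?thesis using s by simp
  qed
  have "C * 1 \<le> C * inner_dual_norm N (y - (- y)) powr p"
    using C one p by (intro mult_left_mono ge_one_powr_ge_zero) auto
  also have "\<dots> \<le> 1"
    using uniform_convexity_slice[OF N uc y, of 0] by (simp add: unit_ball_def is_norm_simps[OF N])
  finally show ?thesis by simp
qed

section \<open>A decomposition of the identity\<close>

text \<open>
  In the Leibniz formula only the identity permutation contributes to first order.
\<close>

lemma has_derivative_det_identity:
  fixes M :: "real^'n^'n"
  shows "((\<lambda>t. det (mat 1 + t *\<^sub>R M)) has_real_derivative trace M) (at 0)"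
proof -
  let ?U = "UNIV :: 'n set"
  let ?f = "\<lambda>p i t. mat 1 $ i $ p i + t * M $ i $ p i"
  define D where "D p = (\<Sum>i\<in>?U. M $ i $ p i * (\<Prod>j\<in>?U - {i}. ?f p j 0))" for p
  have "((\<lambda>t. \<Prod>i\<in>?U. ?f p i t) has_real_derivative D p) (at 0)" for p
    unfolding D_def by (rule has_field_derivative_prod) (auto intro!: derivative_eq_intros)
  then have "((\<lambda>t. \<Sum>p | p permutes ?U. of_int (sign p) * (\<Prod>i\<in>?U. ?f p i t)) has_real_derivative
      (\<Sum>p | p permutes ?U. of_int (sign p) * D p)) (at 0)"
    by (intro DERIV_sum DERIV_cmult)
  moreover have "(\<Sum>p | p permutes ?U. of_int (sign p) * D p) = trace M"
  proof -
    have "D p = 0" if p: "p permutes ?U" "p \<noteq> id" for p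
      unfolding D_def
    proof (rule sum.neutral, rule)
      fix i
      \<comment> \<open>a permutation that is not the identity moves at least two points\<close>
      obtain j where j: "j \<noteq> i" "p j \<noteq> j"
      proof -
        obtain k where k: "p k \<noteq> k" using p(2) by (metis eq_id_iff)
        have "p (p k) \<noteq> p k" using k permutes_inj[OF p(1)] by (auto dest: injD)
        then show ?thesis using that k by metis
      qed
      have "(\<Prod>j\<in>?U - {i}. ?f p j 0) = 0"
        by (rule prod_zero[OF _ bexI[of _ j]]) (use j in \<open>auto simp: mat_def\<close>)
      then show "M $ i $ p i * (\<Prod>j\<in>?U - {i}. ?f p j 0) = 0" by simp
    qed
    then have "(\<Sum>p | p permutes ?U. of_int (sign p) * D p) = (\<Sum>p\<in>{id}. of_int (sign p) * D p)"
      by (intro sum.mono_neutral_right) (auto simp: permutes_id finite_permutations)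
    also have "\<dots> = trace M" by (simp add: D_def trace_def mat_def)
    finally show ?thesis .
  qed
  ultimately show ?thesis unfolding det_def by simp
qed

definition outer_prod :: "real^'n \<Rightarrow> real^'n \<Rightarrow> real^'n^'n" where
  "outer_prod x y = (\<chi> i j. x $ i * y $ j)"

lemma outer_prod_mult_vec: "outer_prod x y *v v = (y \<bullet> v) *\<^sub>R x"
  by (simp add: outer_prod_def matrix_vector_mult_def vec_eq_iff inner_vec_def sum_distrib_left mult_ac)

lemma trace_mult_outer_prod: "trace (A ** outer_prod x y) = y \<bullet> (A *v x)"
proof -
  have "trace (A ** outer_prod x y) = (\<Sum>i\<in>UNIV. \<Sum>k\<in>UNIV. A $ i $ k * (x $ k * y $ i))"
    by (simp add: trace_def matrix_matrix_mult_def outer_prod_def)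
  also have "\<dots> = y \<bullet> (A *v x)"
    by (simp add: inner_vec_def matrix_vector_mult_def sum_distrib_left mult_ac)
  finally show ?thesis .
qed

lemma trace_scaleR: "trace (c *\<^sub>R A) = c * trace (A :: real^'n^'n)"
  by (simp add: trace_def sum_distrib_left)

lemma matrix_mult_scaleR: "A ** (c *\<^sub>R B) = c *\<^sub>R (A ** (B :: real^'n^'n))"
  by (simp add: matrix_matrix_mult_def vec_eq_iff sum_distrib_left mult_ac)

lemma matrix_inv_inverse:
  fixes A :: "real^'n^'n"
  assumes "det A \<noteq> 0"
  shows "A ** matrix_inv A = mat 1" "matrix_inv A ** A = mat 1"
proof -
  have "\<exists>B. A ** B = mat 1 \<and> B ** A = mat 1"
    using assms by (simp add: invertible_det_nz[symmetric] invertible_def)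
  then have "A ** matrix_inv A = mat 1 \<and> matrix_inv A ** A = mat 1"
    unfolding matrix_inv_def by (rule someI_ex)
  then show "A ** matrix_inv A = mat 1" "matrix_inv A ** A = mat 1" by auto
qed

text \<open>
  Moving from \<open>A\<close> towards \<open>B\<close> multiplies the determinant by \<open>det (mat 1 + t *\<^sub>R M)\<close> with
  \<open>M = matrix_inv A ** B - mat 1\<close>; were the trace of \<open>M\<close> positive, the determinant would grow.
\<close>

lemma det_maximizer_first_order:
  fixes \<A> :: "(real^'n^'n) set"
  assumes conv: "convex \<A>" and A: "A \<in> \<A>" "det A > 0" and max: "\<And>B. B \<in> \<A> \<Longrightarrow> det B \<le> det A"
    and B: "B \<in> \<A>"
  shows "trace (matrix_inv A ** B) \<le> real CARD('n)"
proof (rule ccontr)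
  assume neg: "\<not> ?thesis"
  have inv: "A ** matrix_inv A = mat 1" using A(2) by (simp add: matrix_inv_inverse)
  define M where "M = matrix_inv A ** B - mat 1"
  have "trace M > 0" using neg by (simp add: M_def trace_sub trace_I)
  then obtain d where d: "d > 0" "\<And>h. 0 < h \<Longrightarrow> h < d \<Longrightarrow> det (mat 1 + 0 *\<^sub>R M) < det (mat 1 + (0 + h) *\<^sub>R M)"
    using DERIV_pos_inc_right[OF has_derivative_det_identity[of M]] by blast
  define h where "h = min (d / 2) 1"
  have h: "0 < h" "h < d" "h \<le> 1" using d(1) by (auto simp: h_def min_def)
  have "A ** (mat 1 + h *\<^sub>R M) = A + h *\<^sub>R (A ** M)"
    by (simp add: matrix_add_ldistrib matrix_mult_scaleR)
  also have "A ** M = B - A"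
  proof -
    have "A ** M + A ** mat 1 = A ** (M + mat 1)" by (rule matrix_add_ldistrib[symmetric])
    also have "\<dots> = B" by (simp add: M_def matrix_mul_assoc inv)
    finally show ?thesis by (simp add: algebra_simps)
  qed
  also have "A + h *\<^sub>R (B - A) = (1 - h) *\<^sub>R A + h *\<^sub>R B" by (simp add: algebra_simps)
  finally have eq: "A ** (mat 1 + h *\<^sub>R M) = (1 - h) *\<^sub>R A + h *\<^sub>R B" .
  have "(1 - h) *\<^sub>R A + h *\<^sub>R B \<in> \<A>" using h by (intro convexD[OF conv A(1) B]) auto
  then have "det A * det (mat 1 + h *\<^sub>R M) \<le> det A" using max eq by (metis det_mul)
  moreover have "det (mat 1 + h *\<^sub>R M) > 1" using d(2)[OF h(1,2)] by simp
  ultimately show False using A(2) by simp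
qed

lemma axis_eq_outer: "(\<Sum>i\<in>UNIV. outer_prod (axis i 1) (axis i 1)) = (mat 1 :: real^'n^'n)"
  proof -
  have "axis k 1 $ i * axis k 1 $ j = (if k = i \<and> i = j then 1 else (0::real))" for i j k :: 'n
    by (auto simp: axis_def)
  then show ?thesis by (auto simp: outer_prod_def vec_eq_iff mat_def)
qed

text \<open>
  The position of maximal volume of \<open>K\<close> inside the unit ball, obtained from the dual problem. Among
  the averages of rank-one matrices \<open>outer_prod x y\<close> with \<open>x\<close> in \<open>K\<close>, \<open>y\<close> in the polar ball and the
  \<open>y\<close> averaging to zero, let \<open>A\<close> have maximal determinant. The first-order condition bounds
  \<open>trace (matrix_inv A ** B)\<close> on this set only, and the constraint that the \<open>y\<close> average to zero is
  removed by a Lagrange multiplier \<open>w\<close>, supplied by a separating hyperplane. In geometric terms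
  \<open>matrix_inv A\<close> and \<open>w\<close> place \<open>K\<close>, up to scale, inside the ball.
\<close>

lemma centered_decomposition:
  fixes N :: "real^'n \<Rightarrow> real"
  assumes N: "is_norm N" and K: "convex_body K"
  obtains A :: "real^'n^'n" and w :: "real^'n" and k :: nat and p :: "nat \<Rightarrow> real" and x y
  where "det A > 0"
    "\<And>a b. a \<in> K \<Longrightarrow> b \<in> polar_ball N \<Longrightarrow> b \<bullet> (matrix_inv A *v a - w) \<le> real CARD('n)"
    "\<And>i. i \<in> {1..k} \<Longrightarrow> 0 \<le> p i \<and> x i \<in> K \<and> y i \<in> polar_ball N" "(\<Sum>i=1..k. p i) = 1"
    "(\<Sum>i=1..k. p i *\<^sub>R y i) = 0" "(\<Sum>i=1..k. p i *\<^sub>R outer_prod (x i) (y i)) = A"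
proof -
  let ?n = "real CARD('n)"
  define F where "F = (\<lambda>(x::real^'n, y::real^'n). (outer_prod x y, y))"
  define P where "P = convex hull (F ` (K \<times> polar_ball N))"
  define \<A> where "\<A> = {A. (A, 0) \<in> P}"
  have "continuous_on UNIV F"
    unfolding F_def outer_prod_def case_prod_unfold
    by (intro continuous_intros)
  then have "compact (F ` (K \<times> polar_ball N))"
    using K by (intro compact_continuous_image compact_Times compact_polar_ball[OF N])
      (auto simp: convex_body_def intro: continuous_on_subset)
  then have compP: "compact P" unfolding P_def by (rule compact_convex_hull)
  have convP: "convex P" unfolding P_def by (rule convex_convex_hull)
  have FP: "F (a, b) \<in> P" if "a \<in> K" "b \<in> polar_ball N" for a b
    unfolding P_def using that by (intro hull_inc) auto
  have "\<A> = fst ` (P \<inter> (UNIV \<times> {0}))" by (force simp: \<A>_def)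
  moreover have "compact (P \<inter> (UNIV \<times> {0}))"
    by (intro compact_Int_closed compP closed_Times) auto
  ultimately have comp: "compact \<A>"
    by (auto intro!: compact_continuous_image continuous_intros)
  have conv: "convex \<A>"
  proof (rule convexI)
    fix A B and u v :: real assume "A \<in> \<A>" "B \<in> \<A>" "0 \<le> u" "0 \<le> v" "u + v = 1"
    then have "u *\<^sub>R (A, 0) + v *\<^sub>R (B, 0) \<in> P" unfolding \<A>_def by (intro convexD[OF convP]) auto
    then show "u *\<^sub>R A + v *\<^sub>R B \<in> \<A>" by (simp add: \<A>_def)
  qed
  obtain \<delta> where \<delta>: "\<delta> > 0" "\<And>y. norm y \<le> \<delta> \<Longrightarrow> y \<in> polar_ball N" using polar_ball_contains_ball[OF N] by metis
  obtain x0 \<rho> where x0: "\<rho> > 0" "cball x0 \<rho> \<subseteq> K"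
    using K by (meson convex_body_def ex_in_conv mem_interior_cball)
  have axis_mem: "x0 + s *\<^sub>R axis i 1 \<in> K" if "\<bar>s\<bar> \<le> \<rho>" for s i
    using x0(2) that by (auto simp: dist_norm norm_axis_1)
  have K0: "x0 \<in> K" using axis_mem[of 0] x0(1) by simp
  \<comment> \<open>a positive multiple of the identity is an admissible matrix\<close>
  have id: "(\<rho> * \<delta> / ?n) *\<^sub>R mat 1 \<in> \<A>"
  proof -
    have *: "(\<rho> * \<delta>) *\<^sub>R outer_prod (axis i 1) (axis i 1) \<in> \<A>" for i
    proof -
      have "(1/2) *\<^sub>R F (x0 + \<rho> *\<^sub>R axis i 1, \<delta> *\<^sub>R axis i 1) + (1/2) *\<^sub>R F (x0 + (- \<rho>) *\<^sub>R axis i 1, (- \<delta>) *\<^sub>R axis i 1) \<in> P"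
        using x0(1) \<delta>(1) by (intro convexD[OF convP] FP axis_mem \<delta>(2)) (auto simp: norm_axis_1)
      also have "(1/2) *\<^sub>R F (x0 + \<rho> *\<^sub>R axis i 1, \<delta> *\<^sub>R axis i 1) + (1/2) *\<^sub>R F (x0 + (- \<rho>) *\<^sub>R axis i 1, (- \<delta>) *\<^sub>R axis i 1)
          = ((\<rho> * \<delta>) *\<^sub>R outer_prod (axis i 1) (axis i 1), 0)"
        by (simp add: F_def outer_prod_def vec_eq_iff algebra_simps)
      finally show ?thesis by (simp add: \<A>_def)
    qed
    have "(\<Sum>i\<in>UNIV. (1 / ?n) *\<^sub>R ((\<rho> * \<delta>) *\<^sub>R outer_prod (axis i 1) (axis i 1))) \<in> \<A>"
      by (rule convex_sum[OF _ conv]) (auto intro: *)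
    also have "(\<Sum>i\<in>UNIV. (1 / ?n) *\<^sub>R ((\<rho> * \<delta>) *\<^sub>R outer_prod (axis i 1) (axis i 1)))
        = (\<rho> * \<delta> / ?n) *\<^sub>R (mat 1 :: real^'n^'n)"
      unfolding axis_eq_outer[symmetric] by (simp add: scaleR_sum_right)
    finally show ?thesis .
  qed
  have cdet: "continuous_on \<A> det"
    unfolding det_def by (intro continuous_intros)
  obtain A where A: "A \<in> \<A>" "\<And>B. B \<in> \<A> \<Longrightarrow> det B \<le> det A"
    using continuous_attains_sup[OF comp _ cdet] id by blast
  have "det ((\<rho> * \<delta> / ?n) *\<^sub>R (mat 1 :: real^'n^'n)) > 0"
    using x0(1) \<delta>(1) by (subst det_diagonal) (auto simp: mat_def)
  then have detA: "det A > 0" using A(2)[OF id] by linarith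
  note first_order = det_maximizer_first_order[OF conv A(1) detA A(2)]
  define G where "G = (\<lambda>(B, b::real^'n). (trace (matrix_inv A ** B), b))"
  \<comment> \<open>the first-order condition says that the image of \<open>P\<close> misses the open ray above the point \<open>(n, 0)\<close>\<close>
  have linG: "linear G"
    by (rule linearI) (auto simp: G_def matrix_add_ldistrib trace_add trace_scaleR
        matrix_mult_scaleR)
  have "convex (G ` P)" using convP linG by (rule convex_linear_image[rotated])
  moreover have "convex ({?n<..} \<times> {0::real^'n})" by (intro convex_Times) auto
  moreover have "G ` P \<inter> {?n<..} \<times> {0} = {}"
    using first_order by (force simp: G_def \<A>_def)
  moreover have "G ` P \<noteq> {}" using A(1) by (auto simp: \<A>_def)
  moreover have "{?n<..} \<times> {0::real^'n} \<noteq> {}" by (auto intro: gt_ex)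
  ultimately obtain h \<beta> where h: "h \<noteq> 0" "\<And>q. q \<in> G ` P \<Longrightarrow> h \<bullet> q \<le> \<beta>"
      "\<And>q. q \<in> {?n<..} \<times> {0::real^'n} \<Longrightarrow> \<beta> \<le> h \<bullet> q"
    using separating_hyperplane_sets[of "G ` P" "{?n<..} \<times> {0::real^'n}"] by blast
  obtain \<alpha> \<omega> where h_eq: "h = (\<alpha>, \<omega>)" by force
  have lower: "\<alpha> * trace (matrix_inv A ** B) + \<omega> \<bullet> b \<le> \<beta>" if "(B, b) \<in> P" for B b
    using h(2)[OF imageI[OF that]] by (simp add: h_eq G_def)
  have upper: "\<beta> \<le> \<alpha> * s" if "s > ?n" for s using h(3)[of "(s, 0)"] that by (auto simp: h_eq)
  have F_lower: "\<alpha> * (b \<bullet> (matrix_inv A *v a)) + \<omega> \<bullet> b \<le> \<beta>" if "a \<in> K" "b \<in> polar_ball N" for a b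
    using lower[of "outer_prod a b" b] FP[OF that] by (simp add: F_def trace_mult_outer_prod)
  have \<beta>0: "\<beta> \<ge> 0" using F_lower[OF K0 \<delta>(2)[of 0]] \<delta>(1) by simp
  have \<beta>n: "\<beta> \<le> \<alpha> * ?n"
  proof (rule field_le_epsilon)
    fix e :: real assume e: "e > 0"
    have "\<beta> \<le> \<alpha> * (?n + e / (\<bar>\<alpha>\<bar> + 1))" using e by (intro upper) (simp add: add_pos_nonneg)
    also have "\<dots> \<le> \<alpha> * ?n + e * (\<bar>\<alpha>\<bar> / (\<bar>\<alpha>\<bar> + 1))"
      using e by (simp add: algebra_simps mult_right_mono divide_right_mono)
    also have "\<dots> \<le> \<alpha> * ?n + e * 1" using e by (intro add_left_mono mult_left_mono) auto
    finally show "\<beta> \<le> \<alpha> * ?n + e" by simp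
  qed
  \<comment> \<open>the hyperplane is not vertical, since the second components of \<open>P\<close> fill a neighbourhood of \<open>0\<close>\<close>
  have \<alpha>0: "\<alpha> > 0"
  proof -
    have "\<alpha> \<ge> 0" using order_trans[OF \<beta>0 \<beta>n] by (simp add: zero_le_mult_iff)
    moreover have "\<alpha> \<noteq> 0"
    proof
      assume \<alpha>: "\<alpha> = 0"
      then have "\<omega> \<noteq> 0" using h(1) by (simp add: h_eq zero_prod_def)
      have "\<omega> \<bullet> ((\<delta> / norm \<omega>) *\<^sub>R \<omega>) \<le> 0"
        using F_lower[OF K0 \<delta>(2)[of "(\<delta> / norm \<omega>) *\<^sub>R \<omega>"]] \<alpha> \<beta>n \<delta>(1) \<open>\<omega> \<noteq> 0\<close> by simp
      moreover have "\<omega> \<bullet> ((\<delta> / norm \<omega>) *\<^sub>R \<omega>) > 0"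
        using \<open>\<omega> \<noteq> 0\<close> \<delta>(1) by simp
      ultimately show False by simp
    qed
    ultimately show ?thesis by simp
  qed
  define w where "w = - (1 / \<alpha>) *\<^sub>R \<omega>"
  have *: "b \<bullet> (matrix_inv A *v a - w) \<le> ?n" if "a \<in> K" "b \<in> polar_ball N" for a b
  proof -
    have "\<alpha> * (b \<bullet> (matrix_inv A *v a - w)) = \<alpha> * (b \<bullet> (matrix_inv A *v a)) + \<omega> \<bullet> b"
      using \<alpha>0 by (simp add: w_def inner_diff_right inner_commute algebra_simps)
    also have "\<dots> \<le> \<alpha> * ?n" using F_lower[OF that] \<beta>n by linarith
    finally show ?thesis using \<alpha>0 by simp
  qed
  have "(A, 0) \<in> P" using A(1) by (simp add: \<A>_def)
  then obtain k p z where z: "\<And>i. i \<in> {1..k::nat} \<Longrightarrow> 0 \<le> p i \<and> z i \<in> F ` (K \<times> polar_ball N)"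
      "sum p {1..k} = 1" "(\<Sum>i=1..k. p i *\<^sub>R z i) = (A, 0)"
    unfolding P_def convex_hull_indexed by (simp only: mem_Collect_eq) blast
    have "\<forall>i. \<exists>ab. i \<in> {1..k} \<longrightarrow> ab \<in> K \<times> polar_ball N \<and> z i = F ab" using z(1) by blast
  then obtain ab where ab: "\<And>i. i \<in> {1..k} \<Longrightarrow> ab i \<in> K \<times> polar_ball N \<and> z i = F (ab i)" by metis
  have zeq: "(\<Sum>i=1..k. p i *\<^sub>R z i) = (\<Sum>i=1..k. p i *\<^sub>R (outer_prod (fst (ab i)) (snd (ab i)), snd (ab i)))"
    using ab by (intro sum.cong) (auto simp: F_def case_prod_unfold)
  have "(\<Sum>i=1..k. p i *\<^sub>R snd (ab i)) = 0" "(\<Sum>i=1..k. p i *\<^sub>R outer_prod (fst (ab i)) (snd (ab i))) = A"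
    using arg_cong[OF z(3), of fst] arg_cong[OF z(3), of snd] unfolding zeq by (simp_all add: fst_sum snd_sum)
  then show ?thesis
    using that[OF detA *, of k p "\<lambda>i. fst (ab i)" "\<lambda>i. snd (ab i)"] z(1,2) ab by (force simp: mem_Times_iff)
qed

text \<open>
  The matrix decomposition rewritten for the affine image of \<open>K\<close> itself. Translating the points \<open>x i\<close>
  does not disturb the decomposition of the identity, because the \<open>y i\<close> are centred.
\<close>

lemma john_position:
  fixes N :: "real^'n \<Rightarrow> real"
  assumes N: "is_norm N" and K: "convex_body K"
  obtains \<psi> :: "real^'n \<Rightarrow> real^'n" and c and k :: nat and p :: "nat \<Rightarrow> real" and x y
  where "linear \<psi>" "bij \<psi>" "(\<lambda>a. \<psi> a + c) ` K \<subseteq> unit_ball N"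
    "\<And>i. i \<in> {1..k} \<Longrightarrow> 0 \<le> p i" "\<And>i. i \<in> {1..k} \<Longrightarrow> x i \<in> (\<lambda>a. \<psi> a + c) ` K"
    "\<And>i. i \<in> {1..k} \<Longrightarrow> y i \<in> polar_ball N" "(\<Sum>i=1..k. p i) = 1"
    "(\<Sum>i=1..k. p i *\<^sub>R y i) = 0"
    "\<And>v. v = real CARD('n) *\<^sub>R (\<Sum>i=1..k. (p i * (y i \<bullet> v)) *\<^sub>R x i)"
proof -
  let ?n = "real CARD('n)"
  obtain A :: "real^'n^'n" and w k p x y
    where A: "det A > 0"
    and le: "\<And>a b. a \<in> K \<Longrightarrow> b \<in> polar_ball N \<Longrightarrow> b \<bullet> (matrix_inv A *v a - w) \<le> ?n"
    and p: "\<And>i. i \<in> {1..k::nat} \<Longrightarrow> 0 \<le> p i \<and> x i \<in> K \<and> y i \<in> polar_ball N" "(\<Sum>i=1..k. p i) = 1"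
    and y: "(\<Sum>i=1..k. p i *\<^sub>R y i) = 0" and xy: "(\<Sum>i=1..k. p i *\<^sub>R outer_prod (x i) (y i)) = A"
    by (rule centered_decomposition[OF N K]) blast
  define \<psi> where "\<psi> = (\<lambda>a. (1 / ?n) *\<^sub>R (matrix_inv A *v a))"
  define c where "c = - (1 / ?n) *\<^sub>R w"
  have inv: "A ** matrix_inv A = mat 1" "matrix_inv A ** A = mat 1" using A by (simp_all add: matrix_inv_inverse)
  have lin: "linear \<psi>" unfolding \<psi>_def
    by (intro linear_compose_scale_right matrix_vector_mul_linear)
  have bij: "bij \<psi>"
  proof (rule o_bij)
    show "(\<lambda>v. ?n *\<^sub>R (A *v v)) \<circ> \<psi> = id" "\<psi> \<circ> (\<lambda>v. ?n *\<^sub>R (A *v v)) = id"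
      by (auto simp: \<psi>_def fun_eq_iff matrix_vector_mul_assoc inv matrix_vector_mult_scaleR)
  qed
  have sub: "(\<lambda>a. \<psi> a + c) ` K \<subseteq> unit_ball N"
  proof clarify
    fix a assume a: "a \<in> K"
    have "b \<bullet> (\<psi> a + c) \<le> 1" if "b \<in> polar_ball N" for b
    proof -
      have "b \<bullet> (\<psi> a + c) = (b \<bullet> (matrix_inv A *v a - w)) / ?n"
        by (simp add: \<psi>_def c_def inner_add_right inner_diff_right diff_divide_distrib)
      also have "\<dots> \<le> 1" using le[OF a that] by (simp add: divide_le_eq)
      finally show ?thesis .
    qed
    then show "\<psi> a + c \<in> unit_ball N" by (rule bipolar[OF N])
  qed
  have id: "v = ?n *\<^sub>R (\<Sum>i=1..k. (p i * (y i \<bullet> v)) *\<^sub>R (\<psi> (x i) + c))" for v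
  proof -
    have "(\<Sum>i=1..k. (p i * (y i \<bullet> v)) *\<^sub>R (\<psi> (x i) + c))
        = \<psi> (\<Sum>i=1..k. (p i * (y i \<bullet> v)) *\<^sub>R x i) + (\<Sum>i=1..k. p i * (y i \<bullet> v)) *\<^sub>R c"
      by (simp add: linear_sum[OF lin] linear_scale[OF lin] scaleR_add_right sum.distrib scaleR_sum_left)
    also have "(\<Sum>i=1..k. p i * (y i \<bullet> v)) = (\<Sum>i=1..k. p i *\<^sub>R y i) \<bullet> v"
      by (simp add: inner_sum_left)
    also have "(\<Sum>i=1..k. (p i * (y i \<bullet> v)) *\<^sub>R x i) = A *v v"
    proof -
      have "A *v v = (\<Sum>i=1..k. (p i *\<^sub>R outer_prod (x i) (y i)) *v v)"
        unfolding xy[symmetric] by (rule linear_sum[of "\<lambda>B. B *v v"])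
          (auto intro!: linearI simp: matrix_vector_mult_add_rdistrib scaleR_matrix_vector_assoc)
      then show ?thesis by (simp add: scaleR_matrix_vector_assoc[symmetric] outer_prod_mult_vec)
    qed
    finally show ?thesis unfolding y by (simp add: \<psi>_def matrix_vector_mul_assoc inv)
  qed
  show ?thesis
    by (rule that[OF lin bij sub, of k p "\<lambda>i. \<psi> (x i) + c" y]) (use p y id in auto)
qed

section \<open>Barycentric coordinates from a failing inclusion\<close>

text \<open>
  The translations \<open>w\<close> admitting \<open>L \<subseteq> r K + w\<close> form the intersection of the compact convex sets
  \<open>x - r K\<close>, \<open>x \<in> L\<close>. If it is empty, Helly's theorem gives \<open>n + 1\<close> points \<open>v j\<close> of \<open>L\<close> whose sets
  already have no common point, and separating the product of these \<open>n + 1\<close> sets from the diagonal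
  gives the functionals \<open>f j\<close>. The affine functions \<open>h j - f j \<bullet> x\<close> are nonnegative on \<open>K\<close> and add up
  to one: they are barycentric coordinates for a simplex containing \<open>K\<close>.
\<close>

lemma noncovering_functionals:
  fixes K L :: "(real^'n) set"
  assumes K: "convex_body K" and no: "\<And>w. \<not> L \<subseteq> (\<lambda>x. r *\<^sub>R x + w) ` K"
  obtains f :: "'n option \<Rightarrow> real^'n" and h :: "'n option \<Rightarrow> real" and v :: "'n option \<Rightarrow> real^'n"
  where "(\<Sum>j\<in>UNIV. f j) = 0" "(\<Sum>j\<in>UNIV. h j) = 1" "\<And>j x. x \<in> K \<Longrightarrow> f j \<bullet> x \<le> h j"
    "\<And>j. v j \<in> L" "r \<le> (\<Sum>j\<in>UNIV. f j \<bullet> v j)"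
proof -
  define \<F> where "\<F> = (\<lambda>x. (\<lambda>y. x - r *\<^sub>R y) ` K) ` L"
  have K': "compact K" "convex K" "interior K \<noteq> {}" using K by (auto simp: convex_body_def)
  have conv: "\<forall>A\<in>\<F>. convex A"
  proof
    fix A assume "A \<in> \<F>"
    then obtain x where A: "A = (\<lambda>y. x - r *\<^sub>R y) ` K" unfolding \<F>_def by blast
    have "A = (+) x ` (*\<^sub>R) (- r) ` K" unfolding A image_image by simp
    then show "convex A" using convex_translation[OF convex_scaling[OF K'(2)]] by metis
  qed
  have "\<Inter>\<F> = {}"
  proof (rule ccontr)
    assume "\<Inter>\<F> \<noteq> {}"
    then obtain w where w: "\<And>x. x \<in> L \<Longrightarrow> w \<in> (\<lambda>y. x - r *\<^sub>R y) ` K" unfolding \<F>_def by blast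
    have "x \<in> (\<lambda>y. r *\<^sub>R y + w) ` K" if "x \<in> L" for x using w[OF that] by (auto simp: image_iff algebra_simps)
    then show False using no[of w] by blast
  qed
  moreover have "compact A" if "A \<in> \<F>" for A
    using that K'(1) unfolding \<F>_def by (auto intro!: compact_continuous_image continuous_intros)
  ultimately obtain \<G> where \<G>: "finite \<G>" "\<G> \<subseteq> \<F>" "\<Inter>\<G> = {}"
    using compact_fip_Heine_Borel[of \<F>] by metis
  \<comment> \<open>Helly: as many of the sets as the type \<open>'n option\<close> has elements suffice\<close>
  obtain \<H> where \<H>: "finite \<H>" "\<H> \<subseteq> \<F>" "\<Inter>\<H> = {}" "card \<H> \<le> CARD('n option)"
  proof (cases "card \<G> \<le> CARD('n option)")
    case True
    then show ?thesis using \<G> that by blast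
  next
    case False
    then have "\<exists>t\<subseteq>\<G>. card t = DIM(real^'n) + 1 \<and> \<Inter>t = {}"
      using Helly[of \<G>] \<G> conv by (auto simp: subset_iff)
    then obtain t where "t \<subseteq> \<G>" "card t = CARD('n option)" "\<Inter>t = {}" by auto
    then show ?thesis using \<G> that finite_subset by (metis order_refl order_trans)
  qed
  have "\<H> \<noteq> {}" using \<H>(3) by auto
  then obtain A0 where A0: "A0 \<in> \<H>" by blast
  obtain e :: "(real^'n) set \<Rightarrow> 'n option" where e: "inj_on e \<H>"
    using card_le_inj[OF \<H>(1) _ \<H>(4)] by auto
  define A where "A j = (if j \<in> e ` \<H> then inv_into \<H> e j else A0)" for j
  have A: "A j \<in> \<H>" for j unfolding A_def using A0 by (auto simp: inv_into_into)
  have Ae: "A (e B) = B" if "B \<in> \<H>" for B using that e by (simp add: A_def)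
  have "\<forall>j. \<exists>x\<in>L. A j = (\<lambda>y. x - r *\<^sub>R y) ` K" using A \<H>(2) unfolding \<F>_def by blast
  then obtain v where v: "\<And>j. v j \<in> L" "\<And>j. A j = (\<lambda>y. v j - r *\<^sub>R y) ` K" by metis
  define Q :: "((real^'n)^'n option) set" where "Q = {c. \<forall>j. c $ j \<in> A j}"
  define W :: "((real^'n)^'n option) set" where "W = range (\<lambda>w. \<chi> j. w)"
  obtain y0 \<rho> where y0: "\<rho> > 0" "cball y0 \<rho> \<subseteq> K"
    using K'(3) by (meson ex_in_conv mem_interior_cball)
  have y0K: "y0 \<in> K" using y0 by auto
  have "convex Q" unfolding Q_def
  proof (rule convexI, clarify)
    fix c d :: "(real^'n)^'n option" and s t :: real and j
    assume *: "\<forall>j. c $ j \<in> A j" "\<forall>j. d $ j \<in> A j" "0 \<le> s" "0 \<le> t" "s + t = 1"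
    have "convex (A j)" using A \<H>(2) conv by blast
    then show "(s *\<^sub>R c + t *\<^sub>R d) $ j \<in> A j" using * by (simp add: convexD)
  qed
  moreover have "convex W" unfolding W_def
    by (intro convex_linear_image[OF _ convex_UNIV] linearI) (auto simp: vec_eq_iff)
  moreover have "(\<chi> j. v j - r *\<^sub>R y0) \<in> Q" unfolding Q_def using v(2) y0K by auto
  moreover have "W \<noteq> {}" unfolding W_def by blast
  moreover have "Q \<inter> W = {}"
  proof -
    have "\<not> (\<forall>j. w \<in> A j)" for w
    proof
      assume "\<forall>j. w \<in> A j"
      then have "w \<in> \<Inter>\<H>" using Ae by (metis InterI)
      then show False using \<H>(3) by simp
    qed
    then show ?thesis unfolding Q_def W_def by (auto, blast)
  qed
  ultimately obtain a b where a: "a \<noteq> 0" "\<And>c. c \<in> Q \<Longrightarrow> a \<bullet> c \<le> b" "\<And>c. c \<in> W \<Longrightarrow> b \<le> a \<bullet> c"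
    using separating_hyperplane_sets[of Q W] by blast
  have aw: "b \<le> (\<Sum>j\<in>UNIV. a $ j) \<bullet> w" for w
    using a(3)[of "\<chi> j. w"] by (simp add: W_def inner_vec_def[of a] inner_sum_left)
  \<comment> \<open>\<open>W\<close> is a subspace, so a functional bounded below on it vanishes there\<close>
  have b0: "b \<le> 0" using aw[of 0] by simp
  have suma: "(\<Sum>j\<in>UNIV. a $ j) = 0" (is "?s = 0")
  proof (rule ccontr)
    assume ne: "?s \<noteq> 0"
    have "b \<le> ?s \<bullet> (((b - 1) / (?s \<bullet> ?s)) *\<^sub>R ?s)" by (rule aw)
    then show False using ne by simp
  qed
  have sep: "(\<Sum>j\<in>UNIV. a $ j \<bullet> (v j - r *\<^sub>R y j)) \<le> 0" if "\<And>j. y j \<in> K" for y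
  proof -
    have "(\<chi> j. v j - r *\<^sub>R y j) \<in> Q" unfolding Q_def using v(2) that by auto
    from a(2)[OF this] b0 show ?thesis by (simp add: inner_vec_def[of a])
  qed
  have "\<exists>y\<in>K. \<forall>x\<in>K. (- a $ j) \<bullet> x \<le> (- a $ j) \<bullet> y" for j
    using y0K by (intro continuous_attains_sup K'(1) continuous_intros) auto
  then obtain y where y: "\<And>j. y j \<in> K" "\<And>j x. x \<in> K \<Longrightarrow> (- a $ j) \<bullet> x \<le> (- a $ j) \<bullet> y j" by metis
  define H where "H = (\<Sum>j\<in>UNIV. (- a $ j) \<bullet> y j)"
  \<comment> \<open>the supports \<open>(- a $ j) \<bullet> y j\<close> exceed the values at an interior point \<open>y0\<close>, which add up to \<open>0\<close>\<close>
  have Hpos: "H > 0"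
  proof -
    obtain m where m: "a $ m \<noteq> 0" using a(1) by (auto simp: vec_eq_iff)
    define u where "u = (\<lambda>j. if j = m then y0 + (\<rho> / norm (- a $ m)) *\<^sub>R (- a $ m) else y0)"
    have uK: "u j \<in> K" for j unfolding u_def using y0 y0K m by (auto simp: dist_norm)
    have "(\<Sum>j\<in>UNIV. (- a $ j) \<bullet> u j) = (\<Sum>j\<in>UNIV. (- a $ j) \<bullet> y0 + (if j = m then \<rho> * norm (a $ m) else 0))"
      using m by (intro sum.cong) (auto simp: u_def inner_diff_right power2_norm_eq_inner[symmetric] power2_eq_square)
    also have "\<dots> = (\<Sum>j\<in>UNIV. (- a $ j) \<bullet> y0) + \<rho> * norm (a $ m)"
      unfolding sum.distrib by simp
    also have "(\<Sum>j\<in>UNIV. (- a $ j) \<bullet> y0) = 0" using suma by (simp add: sum_negf inner_sum_left[symmetric])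
    finally have "(\<Sum>j\<in>UNIV. (- a $ j) \<bullet> u j) > 0" using m y0(1) by simp
    also have "(\<Sum>j\<in>UNIV. (- a $ j) \<bullet> u j) \<le> H" unfolding H_def by (intro sum_mono y(2) uK)
    finally show ?thesis .
  qed
  show ?thesis
  proof (rule that[of "\<lambda>j. (1 / H) *\<^sub>R (- a $ j)" "\<lambda>j. (1 / H) * ((- a $ j) \<bullet> y j)" v])
    show "(\<Sum>j\<in>UNIV. (1 / H) *\<^sub>R (- a $ j)) = 0"
      using suma by (simp add: scaleR_sum_right[symmetric] sum_negf)
    show "(\<Sum>j\<in>UNIV. (1 / H) * ((- a $ j) \<bullet> y j)) = 1"
      unfolding sum_distrib_left[symmetric] H_def[symmetric] using Hpos by simp
    show "(1 / H) *\<^sub>R (- a $ j) \<bullet> x \<le> (1 / H) * ((- a $ j) \<bullet> y j)" if "x \<in> K" for j x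
      using y(2)[OF that, of j] Hpos by (simp add: divide_right_mono)
    show "v j \<in> L" for j by (rule v(1))
    have "r * H \<le> (\<Sum>j\<in>UNIV. (- a $ j) \<bullet> v j)"
      using sep[of y] y(1) unfolding H_def
      by (simp add: inner_diff_right sum_subtractf sum_negf sum_distrib_left)
    then show "r \<le> (\<Sum>j\<in>UNIV. (1 / H) *\<^sub>R (- a $ j) \<bullet> v j)"
      using Hpos by (simp add: sum_divide_distrib[symmetric] sum_negf) (simp add: field_simps)
  qed
qed

section \<open>Clustering of the functionals\<close>

text \<open>
  The weights \<open>P i * (h j - f j \<bullet> x i)\<close> form a probability distribution on pairs \<open>(i, j)\<close>, and the
  last assumption says that for a random pair the functional \<open>y i\<close> nearly attains its norm at \<open>v j\<close>.
  Thus \<open>j\<close> is a random cluster label for \<open>y i\<close>.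
\<close>

locale near_extremal =
  fixes N :: "'a::euclidean_space \<Rightarrow> real" and K :: "'a set" and p C \<beta> n :: real
    and I :: "'i set" and P :: "'i \<Rightarrow> real" and x y :: "'i \<Rightarrow> 'a"
    and f v :: "'j::finite \<Rightarrow> 'a" and h :: "'j \<Rightarrow> real"
  assumes n: "n = real DIM('a)" and N: "is_norm N" and uc: "uniformly_convex p C (dual_norm N)" and C: "C > 0" and p: "p \<ge> 1"
    and card_j: "CARD('j) = DIM('a) + 1"
    and K: "convex K" "K \<subseteq> unit_ball N"
    and P: "\<And>i. i \<in> I \<Longrightarrow> 0 \<le> P i" "(\<Sum>i\<in>I. P i) = 1"
    and x: "\<And>i. i \<in> I \<Longrightarrow> x i \<in> K" and y: "\<And>i. i \<in> I \<Longrightarrow> y i \<in> polar_ball N"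
    and y_centered: "(\<Sum>i\<in>I. P i *\<^sub>R y i) = 0"
    and identity: "\<And>u. u = n *\<^sub>R (\<Sum>i\<in>I. (P i * (y i \<bullet> u)) *\<^sub>R x i)"
    and f_le: "\<And>j a. a \<in> K \<Longrightarrow> f j \<bullet> a \<le> h j"
    and sum_f: "(\<Sum>j\<in>UNIV. f j) = 0" and sum_h: "(\<Sum>j\<in>UNIV. h j) = 1"
    and v: "\<And>j. v j \<in> unit_ball N"
    and \<beta>: "0 < \<beta>"
    and near: "(\<Sum>i\<in>I. \<Sum>j\<in>UNIV. P i * (h j - f j \<bullet> x i) * (1 - y i \<bullet> v j)) \<le> C * \<beta> powr (p + 1)"
begin

text \<open>
  Notation for the random pair: \<open>m\<close> is its distribution and \<open>q\<close> the marginal distribution of the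
  label, while \<open>D\<close> is the mean distance of a functional from the centre of its cluster.
\<close>

definition g :: "'j \<Rightarrow> 'a \<Rightarrow> real" where "g j a = h j - f j \<bullet> a"

definition m :: "'i \<Rightarrow> 'j \<Rightarrow> real" where "m i j = P i * g j (x i)"

definition q :: "'j \<Rightarrow> real" where "q j = (\<Sum>i\<in>I. m i j)"

text \<open>
  The cluster centre, that is, the conditional mean of \<open>y i\<close> given the label \<open>j\<close>. A label of
  probability zero gets the centre \<open>0\<close>.
\<close>

definition \<eta> :: "'j \<Rightarrow> 'a" where "\<eta> j = (1 / q j) *\<^sub>R (\<Sum>i\<in>I. m i j *\<^sub>R y i)"

definition t :: "'i \<Rightarrow> 'j \<Rightarrow> real" where "t i j = inner_dual_norm N (y i - \<eta> j)"

definition D :: real where "D = (\<Sum>i\<in>I. \<Sum>j\<in>UNIV. m i j * t i j)"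

lemma n_pos: "n > 0"
  by (simp add: n)

lemma finite_I: "finite I"
  using P(2) by (metis sum.infinite zero_neq_one)

lemma g_nonneg: "a \<in> K \<Longrightarrow> 0 \<le> g j a"
  using f_le by (simp add: g_def)

lemma sum_g: "(\<Sum>j\<in>UNIV. g j a) = 1"
  by (simp add: g_def sum_subtractf sum_h inner_sum_left[symmetric] sum_f)

lemma m_nonneg: "i \<in> I \<Longrightarrow> 0 \<le> m i j"
  by (simp add: m_def P x g_nonneg)

lemma sum_m: "(\<Sum>j\<in>UNIV. m i j) = P i"
  by (simp add: m_def sum_distrib_left[symmetric] sum_g)

lemma q_nonneg: "0 \<le> q j"
  unfolding q_def by (intro sum_nonneg m_nonneg)

lemma t_nonneg: "0 \<le> t i j"
  unfolding t_def by (rule inner_dual_norm_nonneg[OF N])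

lemma m_zero: "q j = 0 \<Longrightarrow> i \<in> I \<Longrightarrow> m i j = 0"
  unfolding q_def using sum_nonneg_eq_0_iff[OF finite_I, of "\<lambda>i. m i j"] m_nonneg by blast

lemma q_\<eta>: "q j *\<^sub>R \<eta> j = (\<Sum>i\<in>I. m i j *\<^sub>R y i)"
  by (cases "q j = 0") (simp_all add: \<eta>_def m_zero)

lemma sum_q_\<eta>: "(\<Sum>j\<in>UNIV. q j *\<^sub>R \<eta> j) = 0"
proof -
  have "(\<Sum>j\<in>UNIV. q j *\<^sub>R \<eta> j) = (\<Sum>i\<in>I. \<Sum>j\<in>UNIV. m i j *\<^sub>R y i)"
    unfolding q_\<eta> by (rule sum.swap)
  also have "\<dots> = 0" by (simp add: scaleR_sum_left[symmetric] sum_m y_centered)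
  finally show ?thesis .
qed

lemma average_mem:
  assumes A: "convex A" "\<And>i. i \<in> I \<Longrightarrow> a i \<in> A" and q: "q j \<noteq> 0"
  shows "(1 / q j) *\<^sub>R (\<Sum>i\<in>I. m i j *\<^sub>R a i) \<in> A"
proof -
  have "(\<Sum>i\<in>I. (m i j / q j) *\<^sub>R a i) \<in> A"
    using q q_nonneg[of j]
    by (intro convex_sum[OF finite_I A(1)] A(2)) (auto simp: sum_divide_distrib[symmetric] q_def[symmetric] m_nonneg)
  then show ?thesis by (simp add: scaleR_sum_right)
qed

lemma \<eta>_mem: "\<eta> j \<in> polar_ball N"
proof (cases "q j = 0")
  case True
  then show ?thesis by (simp add: \<eta>_def polar_ball_def)
next
  case False
  then show ?thesis unfolding \<eta>_def by (intro average_mem[OF convex_polar_ball y])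
qed

text \<open>
  The centre \<open>\<eta> j\<close> attains at \<open>v j\<close> the conditional mean of the values \<open>y i \<bullet> v j\<close>, so on average it
  is as close to norming \<open>v j\<close> as the members of its cluster are, and uniform convexity applies to
  the pair \<open>y i\<close>, \<open>\<eta> j\<close>.
\<close>

lemma sum_t_powr: "(\<Sum>i\<in>I. \<Sum>j\<in>UNIV. m i j * t i j powr p) \<le> \<beta> powr (p + 1)"
proof -
  have mean: "(\<Sum>i\<in>I. m i j * (1 - \<eta> j \<bullet> v j)) = (\<Sum>i\<in>I. m i j * (1 - y i \<bullet> v j))" for j
  proof -
    have "(\<Sum>i\<in>I. m i j * (1 - \<eta> j \<bullet> v j)) = q j - (q j *\<^sub>R \<eta> j) \<bullet> v j"
      unfolding sum_distrib_right[symmetric] q_def[symmetric] by (simp add: algebra_simps)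
    also have "\<dots> = (\<Sum>i\<in>I. m i j * (1 - y i \<bullet> v j))"
      unfolding q_\<eta> by (simp add: q_def inner_sum_left sum_subtractf right_diff_distrib)
    finally show ?thesis .
  qed
  have "C * (\<Sum>i\<in>I. \<Sum>j\<in>UNIV. m i j * t i j powr p) = (\<Sum>i\<in>I. \<Sum>j\<in>UNIV. m i j * (C * t i j powr p))"
    by (simp add: sum_distrib_left mult_ac)
  also have "\<dots> \<le> (\<Sum>i\<in>I. \<Sum>j\<in>UNIV. m i j * (((1 - y i \<bullet> v j) + (1 - \<eta> j \<bullet> v j)) / 2))"
    unfolding t_def by (intro sum_mono mult_left_mono uniform_convexity_slice[OF N uc y \<eta>_mem v] m_nonneg)
  also have "\<dots> = (\<Sum>j\<in>UNIV. \<Sum>i\<in>I. m i j * (((1 - y i \<bullet> v j) + (1 - \<eta> j \<bullet> v j)) / 2))"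
    by (rule sum.swap)
  also have "\<dots> = (\<Sum>j\<in>UNIV. ((\<Sum>i\<in>I. m i j * (1 - y i \<bullet> v j)) + (\<Sum>i\<in>I. m i j * (1 - \<eta> j \<bullet> v j))) / 2)"
    by (simp only: distrib_left sum.distrib sum_divide_distrib times_divide_eq_right add_divide_distrib)
  also have "\<dots> = (\<Sum>j\<in>UNIV. \<Sum>i\<in>I. m i j * (1 - y i \<bullet> v j))"
    unfolding mean by simp
  also have "\<dots> = (\<Sum>i\<in>I. \<Sum>j\<in>UNIV. m i j * (1 - y i \<bullet> v j))" by (rule sum.swap)
  also have "\<dots> \<le> C * \<beta> powr (p + 1)" using near by (simp add: m_def g_def)
  finally show ?thesis using C by simp
qed

text \<open>
  A mean of \<open>p\<close>-th powers controls the mean through \<open>s \<le> \<beta> + s powr p * \<beta> powr (1 - p)\<close>, which is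
  trivial for \<open>s \<le> \<beta>\<close> and otherwise follows from \<open>1 \<le> (s / \<beta>) powr (p - 1)\<close>.
\<close>

lemma D_le: "D \<le> \<beta> + \<beta>\<^sup>2"
proof -
  have t_le: "s \<le> \<beta> + s powr p * \<beta> powr (1 - p)" if s: "0 \<le> s" for s
  proof (cases "s \<le> \<beta>")
    case True
    then show ?thesis by (simp add: add_increasing2)
  next
    case False
    have "s = s * 1" by simp
    also have "1 = \<beta> powr (p - 1) * \<beta> powr (1 - p)" using \<beta> by (simp add: powr_add[symmetric])
    also have "s * \<dots> \<le> s * (s powr (p - 1) * \<beta> powr (1 - p))"
      using False \<beta> p by (intro mult_left_mono mult_right_mono powr_mono2) auto
    also have "\<dots> = s powr p * \<beta> powr (1 - p)"
      using False \<beta> powr_mult_base[of s "p - 1"] by (simp add: mult.assoc[symmetric])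
    finally show ?thesis using \<beta> by simp
  qed
  have "D \<le> (\<Sum>i\<in>I. \<Sum>j\<in>UNIV. m i j * (\<beta> + t i j powr p * \<beta> powr (1 - p)))"
    unfolding D_def by (intro sum_mono mult_left_mono t_le t_nonneg m_nonneg)
  also have "\<dots> = (\<Sum>i\<in>I. \<Sum>j\<in>UNIV. m i j) * \<beta> + (\<Sum>i\<in>I. \<Sum>j\<in>UNIV. m i j * t i j powr p) * \<beta> powr (1 - p)"
    by (simp add: distrib_left sum.distrib sum_distrib_left sum_distrib_right mult_ac)
  also have "\<dots> \<le> 1 * \<beta> + \<beta> powr (p + 1) * \<beta> powr (1 - p)"
    by (intro add_mono mult_right_mono sum_t_powr) (use \<beta> in \<open>auto simp: sum_m P\<close>)
  also have "\<beta> powr (p + 1) * \<beta> powr (1 - p) = \<beta>\<^sup>2"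
    using \<beta> by (simp add: powr_add[symmetric] powr_numeral)
  finally show ?thesis by simp
qed

text \<open>
  Replacing every \<open>y i\<close> by its cluster centre in the decomposition of the identity costs at most the
  mean distance \<open>D\<close> to the centres, up to the factor \<open>n\<close>.
\<close>

lemma approximate_identity:
  assumes u: "N u \<le> 1"
  shows "N (u - n *\<^sub>R (\<Sum>j\<in>UNIV. (\<eta> j \<bullet> u) *\<^sub>R (\<Sum>i\<in>I. m i j *\<^sub>R x i))) \<le> n * D"
proof -
  have "(\<Sum>i\<in>I. (P i * (y i \<bullet> u)) *\<^sub>R x i) = (\<Sum>i\<in>I. \<Sum>j\<in>UNIV. (m i j * (y i \<bullet> u)) *\<^sub>R x i)"
    by (simp add: sum_m[symmetric] sum_distrib_right scaleR_sum_left)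
  moreover have "(\<Sum>j\<in>UNIV. (\<eta> j \<bullet> u) *\<^sub>R (\<Sum>i\<in>I. m i j *\<^sub>R x i)) = (\<Sum>i\<in>I. \<Sum>j\<in>UNIV. (m i j * (\<eta> j \<bullet> u)) *\<^sub>R x i)"
    by (subst sum.swap) (simp add: scaleR_sum_right mult_ac)
  ultimately have "u - n *\<^sub>R (\<Sum>j\<in>UNIV. (\<eta> j \<bullet> u) *\<^sub>R (\<Sum>i\<in>I. m i j *\<^sub>R x i))
      = n *\<^sub>R (\<Sum>i\<in>I. \<Sum>j\<in>UNIV. (m i j * ((y i - \<eta> j) \<bullet> u)) *\<^sub>R x i)"
    by (subst identity[of u]) (simp add: inner_diff_left right_diff_distrib scaleR_diff_left sum_subtractf scaleR_diff_right)
  also have "N \<dots> = n * N (\<Sum>i\<in>I. \<Sum>j\<in>UNIV. (m i j * ((y i - \<eta> j) \<bullet> u)) *\<^sub>R x i)"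
    using n_pos by (simp add: is_norm_simps(3)[OF N])
  also have "\<dots> \<le> n * D" unfolding D_def
  proof (intro mult_left_mono order_trans[OF is_norm_sum[OF N]] sum_mono)
    fix i j assume i: "i \<in> I"
    have "\<bar>(y i - \<eta> j) \<bullet> u\<bar> \<le> t i j * N u" unfolding t_def by (rule inner_dual_norm_upper[OF N])
    also have "\<dots> \<le> t i j" by (rule mult_left_le[OF u t_nonneg])
    finally have "\<bar>(y i - \<eta> j) \<bullet> u\<bar> \<le> t i j" .
    moreover have "N (x i) \<le> 1" using x[OF i] K(2) by (auto simp: unit_ball_def)
    ultimately have "m i j * \<bar>(y i - \<eta> j) \<bullet> u\<bar> * N (x i) \<le> m i j * t i j * 1"
      using m_nonneg[OF i] is_norm_simps(5)[OF N] by (intro mult_mono) (auto simp: t_nonneg mult_left_mono)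
    then show "N ((m i j * ((y i - \<eta> j) \<bullet> u)) *\<^sub>R x i) \<le> m i j * t i j"
      using m_nonneg[OF i] by (simp add: is_norm_simps(3)[OF N] abs_mult)
  qed (use n_pos in simp)
  finally show ?thesis .
qed

text \<open>
  There are \<open>n + 1\<close> centres with the single relation \<open>\<Sum>j. q j *\<^sub>R \<eta> j = 0\<close>. Some unit vector \<open>u\<close> is
  annihilated by all centres except \<open>\<eta> j\<close> and \<open>\<eta> k\<close>, and by the relation
  \<open>q j * (\<eta> j \<bullet> u) = - q k * (\<eta> k \<bullet> u)\<close>. If \<open>\<eta> j\<close> and \<open>\<eta> k\<close> were close, or \<open>q k\<close> small, these two
  products would be small, and the approximate identity would almost kill \<open>u\<close>.
\<close>

lemma \<eta>_separated:
  assumes D: "n * D < 1" and jk: "j \<noteq> k"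
  shows "1 - n * D \<le> 2 * n * q k * inner_dual_norm N (\<eta> j - \<eta> k)" and "q k > 0"
proof -
  define X where "X l = (\<Sum>i\<in>I. m i l *\<^sub>R x i)" for l
  have NX: "N (X l) \<le> q l" for l
  proof -
    have "N (X l) \<le> (\<Sum>i\<in>I. N (m i l *\<^sub>R x i))" unfolding X_def by (rule is_norm_sum[OF N])
    also have "\<dots> \<le> (\<Sum>i\<in>I. m i l)"
    proof (rule sum_mono)
      fix i assume i: "i \<in> I"
      have "N (x i) \<le> 1" using x[OF i] K(2) by (auto simp: unit_ball_def)
      then show "N (m i l *\<^sub>R x i) \<le> m i l"
        using m_nonneg[OF i, of l] by (simp add: is_norm_simps(3)[OF N] mult_left_le)
    qed
    finally show ?thesis by (simp add: q_def)
  qed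
  have "dim (\<eta> ` (UNIV - {j, k})) \<le> card (\<eta> ` (UNIV - {j, k}))" by (rule dim_le_card') simp
  also have "\<dots> \<le> card (UNIV - {j, k})" by (rule card_image_le) simp
  also have "\<dots> < DIM('a)" using jk card_j DIM_positive[where 'a='a] by (simp add: card_Diff_subset)
  finally obtain u0 where u0: "u0 \<noteq> 0" "\<And>a. a \<in> span (\<eta> ` (UNIV - {j, k})) \<Longrightarrow> orthogonal u0 a"
    using orthogonal_to_subspace_exists by blast
  define u where "u = u0 /\<^sub>R N u0"
  have Nu: "N u = 1" using is_norm_pos[OF N u0(1)] by (simp add: u_def is_norm_simps(3)[OF N])
  have u_zero: "\<eta> l \<bullet> u = 0" if "l \<noteq> j" "l \<noteq> k" for l
  proof -
    have "\<eta> l \<in> span (\<eta> ` (UNIV - {j, k}))" using that by (intro span_base) auto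
    from u0(2)[OF this] show ?thesis by (simp add: u_def orthogonal_def inner_commute[of _ u0])
  qed
  have two: "(\<Sum>l\<in>UNIV. F l) = F j + F k" if "\<And>l. l \<noteq> j \<Longrightarrow> l \<noteq> k \<Longrightarrow> F l = 0" for F :: "'j \<Rightarrow> 'b::comm_monoid_add"
  proof -
    have "(\<Sum>l\<in>UNIV. F l) = (\<Sum>l\<in>{j, k}. F l)" using that by (intro sum.mono_neutral_right) auto
    then show ?thesis using jk by simp
  qed
  define \<alpha> where "\<alpha> = q k * (\<eta> k \<bullet> u)"
  have "(\<Sum>l\<in>UNIV. q l * (\<eta> l \<bullet> u)) = (\<Sum>l\<in>UNIV. q l *\<^sub>R \<eta> l) \<bullet> u" by (simp add: inner_sum_left)
  then have "(\<Sum>l\<in>UNIV. q l * (\<eta> l \<bullet> u)) = 0" by (simp add: sum_q_\<eta>)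
  moreover have "(\<Sum>l\<in>UNIV. q l * (\<eta> l \<bullet> u)) = q j * (\<eta> j \<bullet> u) + q k * (\<eta> k \<bullet> u)"
    by (rule two) (simp add: u_zero)
  ultimately have \<alpha>j: "q j * (\<eta> j \<bullet> u) = - \<alpha>" by (simp add: \<alpha>_def)
  have "(\<Sum>l\<in>UNIV. (\<eta> l \<bullet> u) *\<^sub>R X l) = (\<eta> j \<bullet> u) *\<^sub>R X j + (\<eta> k \<bullet> u) *\<^sub>R X k"
    by (rule two) (simp add: u_zero)
  then have "N (\<Sum>l\<in>UNIV. (\<eta> l \<bullet> u) *\<^sub>R X l) \<le> N ((\<eta> j \<bullet> u) *\<^sub>R X j) + N ((\<eta> k \<bullet> u) *\<^sub>R X k)"
    by (simp add: is_norm_simps(4)[OF N])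
  also have "\<dots> \<le> \<bar>\<eta> j \<bullet> u\<bar> * q j + \<bar>\<eta> k \<bullet> u\<bar> * q k"
    unfolding is_norm_simps(3)[OF N] by (intro add_mono mult_left_mono NX) auto
  also have "\<dots> = \<bar>q j * (\<eta> j \<bullet> u)\<bar> + \<bar>q k * (\<eta> k \<bullet> u)\<bar>" using q_nonneg by (simp add: abs_mult mult.commute)
  also have "\<dots> = 2 * \<bar>\<alpha>\<bar>" unfolding \<alpha>j by (simp add: \<alpha>_def)
  finally have rank: "N (\<Sum>l\<in>UNIV. (\<eta> l \<bullet> u) *\<^sub>R X l) \<le> 2 * \<bar>\<alpha>\<bar>" .
  have "1 = N ((u - n *\<^sub>R (\<Sum>l\<in>UNIV. (\<eta> l \<bullet> u) *\<^sub>R X l)) + n *\<^sub>R (\<Sum>l\<in>UNIV. (\<eta> l \<bullet> u) *\<^sub>R X l))"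
    using Nu by simp
  also have "\<dots> \<le> N (u - n *\<^sub>R (\<Sum>l\<in>UNIV. (\<eta> l \<bullet> u) *\<^sub>R X l)) + N (n *\<^sub>R (\<Sum>l\<in>UNIV. (\<eta> l \<bullet> u) *\<^sub>R X l))"
    by (rule is_norm_simps(4)[OF N])
  also have "\<dots> \<le> n * D + n * (2 * \<bar>\<alpha>\<bar>)"
    using approximate_identity[of u] Nu rank unfolding X_def
    using n_pos by (intro add_mono) (auto simp: is_norm_simps(3)[OF N] mult_left_mono)
  finally have main: "1 - n * D \<le> 2 * n * \<bar>\<alpha>\<bar>" by simp
  have \<alpha>0: "\<alpha> \<noteq> 0" using main D by auto
  have qk: "q k > 0" and qj: "q j > 0"
    using \<alpha>0 \<alpha>j q_nonneg[of j] q_nonneg[of k] by (auto simp: \<alpha>_def less_le)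
  show "q k > 0" by (rule qk)
  have "\<bar>\<alpha>\<bar> / q k \<le> \<bar>\<alpha>\<bar> / q k + \<bar>\<alpha>\<bar> / q j" using qj by simp
  also have "\<dots> = \<bar>\<alpha>\<bar> * \<bar>1 / q k + 1 / q j\<bar>" using qk qj by (simp add: distrib_left)
  also have "\<dots> = \<bar>\<alpha> / q k + \<alpha> / q j\<bar>" unfolding abs_mult[symmetric] by (simp add: distrib_left)
  also have "\<alpha> / q k = \<eta> k \<bullet> u" using qk by (simp add: \<alpha>_def)
  also have "\<alpha> / q j = - (\<eta> j \<bullet> u)" using qj \<alpha>j by (simp add: field_simps)
  also have "\<bar>\<eta> k \<bullet> u + - (\<eta> j \<bullet> u)\<bar> = \<bar>(\<eta> j - \<eta> k) \<bullet> u\<bar>" by (simp add: inner_diff_left abs_minus_commute)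
  also have "\<dots> \<le> inner_dual_norm N (\<eta> j - \<eta> k)"
    using inner_dual_norm_upper[OF N, of "\<eta> j - \<eta> k" u] Nu by simp
  finally have "\<bar>\<alpha>\<bar> \<le> q k * inner_dual_norm N (\<eta> j - \<eta> k)" using qk by (simp add: divide_le_eq mult.commute)
  then have "2 * n * \<bar>\<alpha>\<bar> \<le> 2 * n * (q k * inner_dual_norm N (\<eta> j - \<eta> k))"
    using n_pos by (intro mult_left_mono) auto
  then show "1 - n * D \<le> 2 * n * q k * inner_dual_norm N (\<eta> j - \<eta> k)" using main by simp
qed

text \<open>
  The candidate for the vertex opposite to \<open>g k = 0\<close> is the conditional mean \<open>z\<close> of \<open>x i\<close> given the
  label \<open>k\<close>. The defect \<open>q k * (1 - g k z)\<close> is the probability that two labels drawn independently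
  for the same \<open>i\<close> are \<open>k\<close> and some \<open>j \<noteq> k\<close>. In that event \<open>y i\<close> cannot be near both \<open>\<eta> j\<close> and \<open>\<eta> k\<close>,
  as these centres are apart; so the event is rare. The factor \<open>q k\<close> in the separation of the centres
  cancels against the one in the defect.
\<close>

lemma almost_vertex:
  assumes D: "n * D < 1"
  shows "\<exists>z\<in>K. (1 - n * D) * (1 - g k z) \<le> 4 * n * D"
proof -
  have "card (UNIV - {k}) > 0" using card_j DIM_positive[where 'a='a] by simp
  then obtain j0 where "j0 \<noteq> k" by (metis DiffD2 card.empty ex_in_conv insertI1 less_irrefl)
  then have qk: "q k > 0" using \<eta>_separated(2)[OF D] by blast
  define z where "z = (1 / q k) *\<^sub>R (\<Sum>i\<in>I. m i k *\<^sub>R x i)"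
  have zK: "z \<in> K" unfolding z_def using qk by (intro average_mem[OF K(1) x]) auto
  have "q k * (1 - g k z) = q k * (1 - h k) + f k \<bullet> (q k *\<^sub>R z)" by (simp add: g_def algebra_simps)
  also have "q k *\<^sub>R z = (\<Sum>i\<in>I. m i k *\<^sub>R x i)" using qk by (simp add: z_def)
  also have "q k * (1 - h k) + f k \<bullet> (\<Sum>i\<in>I. m i k *\<^sub>R x i) = (\<Sum>i\<in>I. m i k * (1 - g k (x i)))"
    by (simp add: q_def g_def inner_sum_right sum_distrib_left sum.distrib sum_subtractf algebra_simps)
  also have "\<dots> = (\<Sum>i\<in>I. \<Sum>j\<in>UNIV - {k}. m i k * g j (x i))"
  proof (rule sum.cong[OF refl])
    fix i
    have "1 - g k (x i) = (\<Sum>j\<in>UNIV - {k}. g j (x i))"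
      using sum_g[of "x i"] sum.remove[of UNIV k "\<lambda>j. g j (x i)"] by simp
    then show "m i k * (1 - g k (x i)) = (\<Sum>j\<in>UNIV - {k}. m i k * g j (x i))" by (simp add: sum_distrib_left)
  qed
  finally have mass: "q k * (1 - g k z) = (\<Sum>i\<in>I. \<Sum>j\<in>UNIV - {k}. m i k * g j (x i))" .
  have "(1 - n * D) * (q k * (1 - g k z)) = (\<Sum>i\<in>I. \<Sum>j\<in>UNIV - {k}. (m i k * g j (x i)) * (1 - n * D))"
    unfolding mass by (simp add: sum_distrib_left sum_distrib_right mult_ac)
  also have "\<dots> \<le> (\<Sum>i\<in>I. \<Sum>j\<in>UNIV - {k}. (m i k * g j (x i)) * (2 * n * q k * (t i j + t i k)))"
  proof (intro sum_mono mult_left_mono)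
    fix i j assume i: "i \<in> I" and j: "j \<in> UNIV - {k}"
    have "1 - n * D \<le> 2 * n * q k * inner_dual_norm N (\<eta> j - \<eta> k)" using j by (intro \<eta>_separated(1)[OF D]) auto
    also have "\<dots> \<le> 2 * n * q k * (t i j + t i k)"
      unfolding t_def using qk by (intro mult_left_mono inner_dual_norm_diff_triangle[OF N]) (use n_pos in auto)
    finally show "1 - n * D \<le> 2 * n * q k * (t i j + t i k)" .
    show "0 \<le> m i k * g j (x i)" by (intro mult_nonneg_nonneg m_nonneg g_nonneg x i)
  qed
  also have "\<dots> = 2 * n * q k * (\<Sum>i\<in>I. \<Sum>j\<in>UNIV - {k}. (m i k * g j (x i)) * (t i j + t i k))"
    by (simp add: sum_distrib_left mult_ac)
  also have "\<dots> \<le> 2 * n * q k * (2 * D)"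
  proof (intro mult_left_mono)
    have g1: "g k (x i) \<le> 1" if "i \<in> I" for i
      using sum_g[of "x i"] member_le_sum[of k UNIV "\<lambda>j. g j (x i)"] g_nonneg[OF x[OF that]] by simp
    have "(\<Sum>j\<in>UNIV - {k}. (m i k * g j (x i)) * (t i j + t i k)) \<le> (\<Sum>j\<in>UNIV. m i j * t i j) + m i k * t i k"
      if i: "i \<in> I" for i
    proof -
      have "(\<Sum>j\<in>UNIV - {k}. (m i k * g j (x i)) * (t i j + t i k)) \<le> (\<Sum>j\<in>UNIV. (m i k * g j (x i)) * (t i j + t i k))"
        by (intro sum_mono2 mult_nonneg_nonneg add_nonneg_nonneg m_nonneg g_nonneg x t_nonneg i) auto
      also have "\<dots> = g k (x i) * (\<Sum>j\<in>UNIV. m i j * t i j) + m i k * t i k * (\<Sum>j\<in>UNIV. g j (x i))"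
        by (simp add: m_def distrib_left sum.distrib sum_distrib_left sum_distrib_right mult_ac)
      also have "\<dots> \<le> 1 * (\<Sum>j\<in>UNIV. m i j * t i j) + m i k * t i k * 1"
        unfolding sum_g by (intro add_mono mult_right_mono g1 i sum_nonneg mult_nonneg_nonneg m_nonneg t_nonneg) auto
      finally show ?thesis by simp
    qed
    then have "(\<Sum>i\<in>I. \<Sum>j\<in>UNIV - {k}. (m i k * g j (x i)) * (t i j + t i k))
        \<le> (\<Sum>i\<in>I. (\<Sum>j\<in>UNIV. m i j * t i j) + m i k * t i k)" by (rule sum_mono)
    also have "\<dots> \<le> (\<Sum>i\<in>I. (\<Sum>j\<in>UNIV. m i j * t i j) + (\<Sum>j\<in>UNIV. m i j * t i j))"
      by (intro sum_mono add_left_mono member_le_sum mult_nonneg_nonneg m_nonneg t_nonneg) auto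
    also have "\<dots> = 2 * D" by (simp add: D_def sum.distrib sum_distrib_left)
    finally show "(\<Sum>i\<in>I. \<Sum>j\<in>UNIV - {k}. (m i k * g j (x i)) * (t i j + t i k)) \<le> 2 * D" .
  qed (use qk n_pos in auto)
  finally have "q k * ((1 - n * D) * (1 - g k z)) \<le> q k * (4 * n * D)" by (simp add: mult_ac)
  then have "(1 - n * D) * (1 - g k z) \<le> 4 * n * D" using qk by simp
  then show ?thesis using zK by blast
qed

end

section \<open>Bodies that almost contain the vertices of a simplex\<close>

text \<open>
  The points \<open>b k\<close> have barycentric coordinates close to those of the vertices \<open>a k\<close>. If the point with
  coordinates \<open>s\<close> lay outside their hull, a separating affine function would have positive mean with
  respect to each row of \<open>M\<close> and negative mean with respect to \<open>s\<close>. With \<open>l i\<close> its minimum and \<open>l j\<close>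
  its maximum over the vertices, row \<open>i\<close> has mean at most \<open>(1 - \<tau>) * l i + \<tau> * l j\<close> and \<open>s\<close> has mean
  at least that.
\<close>

lemma shrunken_simplex_subset:
  fixes a b :: "'j::finite \<Rightarrow> 'a::euclidean_space" and M :: "'j \<Rightarrow> 'j \<Rightarrow> real"
  assumes M: "\<And>k j. 0 \<le> M k j" "\<And>k. (\<Sum>j\<in>UNIV. M k j) = 1" "\<And>k. 1 - \<tau> \<le> M k k"
    and b: "\<And>k. b k = (\<Sum>j\<in>UNIV. M k j *\<^sub>R a j)"
    and \<tau>: "0 \<le> \<tau>" and s: "\<And>j. \<tau> \<le> s j" "(\<Sum>j\<in>UNIV. s j) = 1"
  shows "(\<Sum>j\<in>UNIV. s j *\<^sub>R a j) \<in> convex hull (range b)"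
proof (rule ccontr)
  assume no: "(\<Sum>j\<in>UNIV. s j *\<^sub>R a j) \<notin> convex hull (range b)"
  have "closed (convex hull (range b))"
    by (intro compact_imp_closed finite_imp_compact_convex_hull) simp
  then obtain \<omega> \<gamma> where sep: "\<omega> \<bullet> (\<Sum>j\<in>UNIV. s j *\<^sub>R a j) < \<gamma>" "\<And>z. z \<in> convex hull (range b) \<Longrightarrow> \<gamma> < \<omega> \<bullet> z"
    using separating_hyperplane_closed_point[OF convex_convex_hull _ no] by blast
  define l where "l j = \<omega> \<bullet> a j - \<gamma>" for j
  have affine: "(\<Sum>j\<in>UNIV. c j * l j) = \<omega> \<bullet> (\<Sum>j\<in>UNIV. c j *\<^sub>R a j) - \<gamma>" if "(\<Sum>j\<in>UNIV. c j) = 1" for c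
    using that by (simp add: l_def inner_sum_right right_diff_distrib sum_subtractf sum_distrib_right[symmetric])
  have neg: "(\<Sum>j\<in>UNIV. s j * l j) < 0" using sep(1) affine[OF s(2)] by simp
  have pos: "0 < (\<Sum>j\<in>UNIV. M k j * l j)" for k
    using sep(2)[OF hull_inc[OF rangeI[of b k]]] unfolding affine[OF M(2)] b by simp
  have fin: "finite (range l)" "range l \<noteq> {}" by auto
  obtain i where i: "l i = Min (range l)" using Min_in[OF fin] by (metis imageE)
  obtain j where j: "l j = Max (range l)" using Max_in[OF fin] by (metis imageE)
  have bounds: "l i \<le> l k" "l k \<le> l j" for k using fin by (simp_all add: i j)
  have "0 < (\<Sum>k\<in>UNIV. M i k * l k)" by (rule pos)
  also have "\<dots> = M i i * l i + (\<Sum>k\<in>UNIV - {i}. M i k * l k)" by (simp add: sum.remove)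
  also have "\<dots> \<le> M i i * l i + (\<Sum>k\<in>UNIV - {i}. M i k * l j)"
    by (intro add_left_mono sum_mono mult_left_mono bounds M)
  also have "(\<Sum>k\<in>UNIV - {i}. M i k * l j) = (1 - M i i) * l j"
    using sum.remove[of UNIV i "M i"] M(2)[of i] by (simp add: sum_distrib_right[symmetric])
  also have "M i i * l i + (1 - M i i) * l j = l j - M i i * (l j - l i)" by (simp add: algebra_simps)
  also have "\<dots> \<le> l j - (1 - \<tau>) * (l j - l i)"
    using bounds(1)[of j] by (intro diff_left_mono mult_right_mono M) auto
  also have "\<dots> = l i + \<tau> * (l j - l i)" by (simp add: algebra_simps)
  also have "\<dots> \<le> l i + s j * (l j - l i)" using bounds(1)[of j] by (intro add_left_mono mult_right_mono s) auto
  also have "\<dots> \<le> l i + (\<Sum>k\<in>UNIV. s k * (l k - l i))"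
    using order_trans[OF \<tau> s(1)] bounds(1) by (intro add_left_mono member_le_sum mult_nonneg_nonneg) auto
  also have "\<dots> = (\<Sum>k\<in>UNIV. s k * l k)"
    using s(2) by (simp add: right_diff_distrib sum_subtractf sum_distrib_right[symmetric])
  finally show False using neg by simp
qed

lemma simplex_not_in_hyperplane:
  fixes a :: "'j::finite \<Rightarrow> 'a::euclidean_space"
  assumes "interior (convex hull (range a)) \<noteq> {}" and \<omega>: "\<omega> \<noteq> 0"
  shows "\<exists>j k. \<omega> \<bullet> a j \<noteq> \<omega> \<bullet> a k"
proof (rule ccontr)
  assume "\<not> ?thesis"
  then have "range a \<subseteq> {z. \<omega> \<bullet> z = \<omega> \<bullet> a undefined}" by blast
  then have "convex hull (range a) \<subseteq> {z. \<omega> \<bullet> z = \<omega> \<bullet> a undefined}"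
    by (rule hull_minimal) (rule convex_hyperplane)
  then have "interior (convex hull (range a)) \<subseteq> interior {z. \<omega> \<bullet> z = \<omega> \<bullet> a undefined}" by (rule interior_mono)
  then show False using assms by simp
qed

text \<open>
  The affine map with barycentric coordinates \<open>h j - f j \<bullet> x\<close> sends \<open>K\<close> into the simplex, and the
  images of the points \<open>z k\<close> are near the vertices. Hence the image of \<open>K\<close> contains the points of
  the simplex whose coordinates are at least \<open>\<tau>\<close>, a homothetic copy of it with ratio
  \<open>1 - CARD('j) * \<tau>\<close>. Having nonempty interior, this copy also forces the map to be a bijection.
\<close>

lemma simplex_sandwich:
  fixes a f z :: "'j::finite \<Rightarrow> 'a::euclidean_space" and h :: "'j \<Rightarrow> real"
  assumes S: "interior (convex hull (range a)) \<noteq> {}" and K: "convex K"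
    and f_le: "\<And>j x. x \<in> K \<Longrightarrow> f j \<bullet> x \<le> h j"
    and sum_f: "(\<Sum>j\<in>UNIV. f j) = 0" and sum_h: "(\<Sum>j\<in>UNIV. h j) = 1"
    and z: "\<And>k. z k \<in> K" "\<And>k. 1 - \<tau> \<le> h k - f k \<bullet> z k"
    and \<tau>: "0 \<le> \<tau>" "real CARD('j) * \<tau> < 1" 
  obtains \<phi> :: "'a \<Rightarrow> 'a" and c w where "linear \<phi>" "bij \<phi>"
    "\<And>x. x \<in> K \<Longrightarrow> \<phi> x + c \<in> convex hull (range a)"
    "\<And>s. s \<in> convex hull (range a) \<Longrightarrow> \<exists>x\<in>K. s = (1 / (1 - real CARD('j) * \<tau>)) *\<^sub>R \<phi> x + w"
proof -
  define \<rho> where "\<rho> = 1 - real CARD('j) * \<tau>"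
  have \<rho>: "\<rho> > 0" using \<tau> by (simp add: \<rho>_def)
  define \<phi> where "\<phi> = (\<lambda>x. \<Sum>j\<in>UNIV. - (f j \<bullet> x) *\<^sub>R a j)"
  define c where "c = (\<Sum>j\<in>UNIV. h j *\<^sub>R a j)"
  have lin: "linear \<phi>"
    by (rule linearI) (simp_all add: \<phi>_def inner_add_right scaleR_add_left sum.distrib scaleR_sum_right sum_negf)
  have \<Phi>: "\<phi> x + c = (\<Sum>j\<in>UNIV. (h j - f j \<bullet> x) *\<^sub>R a j)" for x
    by (simp add: \<phi>_def c_def scaleR_diff_left sum_subtractf sum_negf)
  have sum_g: "(\<Sum>j\<in>UNIV. h j - f j \<bullet> x) = 1" for x
    by (simp add: sum_subtractf sum_h inner_sum_left[symmetric] sum_f)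
  have inner: "\<phi> x + c \<in> convex hull (range a)" if "x \<in> K" for x
    unfolding \<Phi> using f_le[OF that] by (intro convex_sum convex_convex_hull sum_g hull_inc) auto
  have hull_vertices: "convex hull (range (\<lambda>k. \<phi> (z k) + c)) \<subseteq> (\<lambda>x. \<phi> x + c) ` K"
  proof (rule hull_minimal)
    show "range (\<lambda>k. \<phi> (z k) + c) \<subseteq> (\<lambda>x. \<phi> x + c) ` K" using z(1) by blast
    have "(\<lambda>x. \<phi> x + c) ` K = (+) c ` \<phi> ` K" by (auto simp: image_iff add.commute)
    then show "convex ((\<lambda>x. \<phi> x + c) ` K)" using convex_translation[OF convex_linear_image[OF lin K]] by metis
  qed
  have shrunk: "\<exists>x\<in>K. \<rho> *\<^sub>R s + \<tau> *\<^sub>R (\<Sum>j\<in>UNIV. a j) = \<phi> x + c" if s: "s \<in> convex hull (range a)" for s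
  proof -
    \<comment> \<open>barycentric coordinates of \<open>s\<close>; the family \<open>a\<close> may have repetitions, so weights are indexed by \<open>j\<close>\<close>
    obtain l where l: "\<And>j. 0 \<le> l j" "(\<Sum>j\<in>UNIV. l j) = 1" "(\<Sum>j\<in>UNIV. l j *\<^sub>R a j) = s"
    proof -
      have "s \<in> {u. \<exists>l. (\<forall>j\<in>UNIV. 0 \<le> l j) \<and> sum l UNIV = 1 \<and> (\<Sum>j\<in>UNIV. l j *\<^sub>R a j) = u}"
      proof (rule subsetD[OF hull_minimal s])
        show "range a \<subseteq> {u. \<exists>l. (\<forall>j\<in>UNIV. 0 \<le> l j) \<and> sum l UNIV = 1 \<and> (\<Sum>j\<in>UNIV. l j *\<^sub>R a j) = u}"
        proof clarify
          fix k
          show "\<exists>l. (\<forall>j\<in>UNIV. 0 \<le> l j) \<and> sum l UNIV = (1::real) \<and> (\<Sum>j\<in>UNIV. l j *\<^sub>R a j) = a k"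
            by (rule exI[of _ "\<lambda>j. if j = k then 1 else 0"]) (auto simp: if_distrib[of "\<lambda>t. t *\<^sub>R _"] cong: if_cong)
        qed
        show "convex {u. \<exists>l. (\<forall>j\<in>UNIV. 0 \<le> l j) \<and> sum l UNIV = (1::real) \<and> (\<Sum>j\<in>UNIV. l j *\<^sub>R a j) = u}"
        proof (rule convexI, clarify)
          fix l l' :: "'j \<Rightarrow> real" and u v :: real
          assume *: "0 \<le> u" "0 \<le> v" "u + v = 1" "\<forall>j\<in>UNIV. 0 \<le> l j" "sum l UNIV = 1" "\<forall>j\<in>UNIV. 0 \<le> l' j" "sum l' UNIV = 1"
          show "\<exists>L. (\<forall>j\<in>UNIV. 0 \<le> L j) \<and> sum L UNIV = (1::real) \<and> (\<Sum>j\<in>UNIV. L j *\<^sub>R a j) = u *\<^sub>R (\<Sum>j\<in>UNIV. l j *\<^sub>R a j) + v *\<^sub>R (\<Sum>j\<in>UNIV. l' j *\<^sub>R a j)"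
            by (rule exI[of _ "\<lambda>j. u * l j + v * l' j"])
              (use * in \<open>simp add: sum.distrib sum_distrib_left[symmetric] scaleR_add_left scaleR_sum_right\<close>)
        qed
      qed
      then show ?thesis using that by blast
    qed
    have "(\<Sum>j\<in>UNIV. (\<rho> * l j + \<tau>) *\<^sub>R a j) \<in> convex hull (range (\<lambda>k. \<phi> (z k) + c))"
    proof (rule shrunken_simplex_subset[where \<tau> = \<tau> and M = "\<lambda>k j. h j - f j \<bullet> z k"])
      show "(\<Sum>j\<in>UNIV. \<rho> * l j + \<tau>) = 1"
        by (simp add: sum.distrib sum_distrib_left[symmetric] l(2) \<rho>_def)
    qed (use f_le[OF z(1)] z(2) sum_g \<Phi> \<rho> l(1) \<tau> in auto)
    moreover have "(\<Sum>j\<in>UNIV. (\<rho> * l j + \<tau>) *\<^sub>R a j) = \<rho> *\<^sub>R s + \<tau> *\<^sub>R (\<Sum>j\<in>UNIV. a j)"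
      unfolding l(3)[symmetric] by (simp add: scaleR_add_left sum.distrib scaleR_sum_right)
    ultimately show ?thesis using hull_vertices by auto
  qed
  have bij: "bij \<phi>"
  proof -
    have "range \<phi> = UNIV"
    proof (rule ccontr)
      assume ne: "range \<phi> \<noteq> UNIV"
      have sub: "subspace (range \<phi>)" using lin by (simp add: linear_subspace_image)
      then have "dim (range \<phi>) < DIM('a)" using ne by (metis dim_eq_full dim_subset_UNIV le_neq_implies_less span_eq_iff)
      then obtain \<omega> where \<omega>: "\<omega> \<noteq> 0" "\<And>y. y \<in> span (range \<phi>) \<Longrightarrow> orthogonal \<omega> y"
        using orthogonal_to_subspace_exists by blast
      have orth: "\<omega> \<bullet> \<phi> x = 0" for x using \<omega>(2)[OF span_base[OF rangeI]] by (simp add: orthogonal_def)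
      have "\<rho> * (\<omega> \<bullet> a j) + \<tau> * (\<omega> \<bullet> (\<Sum>j\<in>UNIV. a j)) = \<omega> \<bullet> c" for j
      proof -
        obtain x where "\<rho> *\<^sub>R a j + \<tau> *\<^sub>R (\<Sum>j\<in>UNIV. a j) = \<phi> x + c" using shrunk[OF hull_inc[OF rangeI]] by blast
        then have "\<omega> \<bullet> (\<rho> *\<^sub>R a j + \<tau> *\<^sub>R (\<Sum>j\<in>UNIV. a j)) = \<omega> \<bullet> (\<phi> x + c)" by simp
        then show ?thesis by (simp add: inner_add_right orth)
      qed
      then have "\<rho> * (\<omega> \<bullet> a j) = \<rho> * (\<omega> \<bullet> a k)" for j k by (metis add_right_cancel)
      then show False using simplex_not_in_hyperplane[OF S \<omega>(1)] \<rho> by simp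
    qed
    then show ?thesis using lin by (simp add: bij_def linear_surjective_imp_injective)
  qed
  show ?thesis
  proof (rule that[OF lin bij inner])
    fix s assume "s \<in> convex hull (range a)"
    then obtain x where x: "x \<in> K" "\<rho> *\<^sub>R s + \<tau> *\<^sub>R (\<Sum>j\<in>UNIV. a j) = \<phi> x + c" using shrunk by blast
    then have "\<rho> *\<^sub>R s = \<phi> x + (c - \<tau> *\<^sub>R (\<Sum>j\<in>UNIV. a j))" by (simp add: algebra_simps)
    then have "(1 / \<rho>) *\<^sub>R \<rho> *\<^sub>R s = (1 / \<rho>) *\<^sub>R (\<phi> x + (c - \<tau> *\<^sub>R (\<Sum>j\<in>UNIV. a j)))" by simp
    then have "s = (1 / \<rho>) *\<^sub>R \<phi> x + (1 / \<rho>) *\<^sub>R (c - \<tau> *\<^sub>R (\<Sum>j\<in>UNIV. a j))"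
      using \<rho> by (simp add: scaleR_add_right)
    then show "\<exists>x\<in>K. s = (1 / (1 - real CARD('j) * \<tau>)) *\<^sub>R \<phi> x + (1 / \<rho>) *\<^sub>R (c - \<tau> *\<^sub>R (\<Sum>j\<in>UNIV. a j))"
      using x(1) unfolding \<rho>_def by blast
  qed
qed

section \<open>The stability estimate\<close>

text \<open>
  Here the ingredients meet. If the distance of \<open>K\<close> to the ball exceeds \<open>r = (1 - \<epsilon>) n\<close>, then in
  John position no translate of \<open>r K\<close> covers the ball, so barycentric coordinates \<open>h j - f j \<bullet> x\<close>
  and points \<open>v j\<close> exist. Evaluating them along the decomposition of the identity turns the
  inequality \<open>r \<le> \<Sum>j. f j \<bullet> v j\<close> into the statement that, on average, \<open>y i\<close> nearly attains its
  norm at \<open>- v j\<close>.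
\<close>

lemma banach_mazur_simplex_le:
  fixes N :: "real^'n \<Rightarrow> real" and a :: "'n option \<Rightarrow> real^'n"
  assumes n: "n = real CARD('n)" "n \<ge> 2" and N: "is_norm N" and K: "convex_body K"
    and S: "interior (convex hull (range a)) \<noteq> {}"
    and p: "p \<ge> 1" and C: "C > 0" and uc: "uniformly_convex p C (dual_norm N)"
    and \<beta>: "0 < \<beta>" "\<beta> \<le> 1 / (20 * n ^ 4)"
    and far: "banach_mazur K (unit_ball N) > (1 - C * \<beta> powr (p + 1)) * n"
  shows "banach_mazur K (convex hull (range a)) \<le> 1 + 48 * n\<^sup>2 * \<beta>"
proof -
  let ?\<epsilon> = "C * \<beta> powr (p + 1)"
  define r where "r = (1 - ?\<epsilon>) * n"
  have n4: "n ^ 4 \<ge> 16" using power_mono[of 2 n 4] n(2) by simp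
  have n4\<beta>: "20 * (n ^ 4 * \<beta>) \<le> 1" using \<beta>(2) n(2) by (simp add: field_simps)
  have \<beta>20: "\<beta> \<le> 1 / 20" using \<beta>(1) mult_right_mono[OF n4 less_imp_le[OF \<beta>(1)]] n4\<beta> by linarith
  have "?\<epsilon> \<le> 1 * \<beta> powr 1"
    using \<beta>(1) \<beta>20 p C uniformly_convex_constant_le_1[OF N uc _ C] by (intro mult_mono powr_mono') auto
  then have \<epsilon>: "?\<epsilon> \<le> 1 / 20" using \<beta>(1) \<beta>20 by simp
  have r1: "r > 1"
    using mult_mono[of "19 / 20" "1 - ?\<epsilon>" 2 n] \<epsilon> n(2) by (simp add: r_def)
  obtain \<psi> c k P x y where \<psi>: "linear \<psi>" "bij \<psi>"
    and sub: "(\<lambda>a. \<psi> a + c) ` K \<subseteq> unit_ball N"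
    and P: "\<And>i. i \<in> {1..k::nat} \<Longrightarrow> 0 \<le> P i" "(\<Sum>i=1..k. P i) = 1"
    and x: "\<And>i. i \<in> {1..k} \<Longrightarrow> x i \<in> (\<lambda>a. \<psi> a + c) ` K"
    and y: "\<And>i. i \<in> {1..k} \<Longrightarrow> y i \<in> polar_ball N" "(\<Sum>i=1..k. P i *\<^sub>R y i) = 0"
    and id: "\<And>u. u = real CARD('n) *\<^sub>R (\<Sum>i=1..k. (P i * (y i \<bullet> u)) *\<^sub>R x i)"
    by (rule john_position[OF N K]) blast
  define K' where "K' = (\<lambda>a. \<psi> a + c) ` K"
  have K': "convex_body K'" unfolding K'_def by (rule convex_body_affine_image[OF K \<psi>])
  have no: "\<not> unit_ball N \<subseteq> (\<lambda>x. r *\<^sub>R x + w) ` K'" for w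
  proof
    assume cover: "unit_ball N \<subseteq> (\<lambda>x. r *\<^sub>R x + w) ` K'"
    have "banach_mazur K (unit_ball N) \<le> r"
    proof (rule banach_mazur_le[OF \<psi> r1])
      show "\<psi> a + c \<in> unit_ball N" if "a \<in> K" for a using sub that by blast
      fix s assume "s \<in> unit_ball N"
      then obtain a where "a \<in> K" "s = r *\<^sub>R (\<psi> a + c) + w" using cover unfolding K'_def by blast
      then show "\<exists>a\<in>K. s = r *\<^sub>R \<psi> a + (r *\<^sub>R c + w)"
        by (intro bexI[of _ a]) (simp_all add: scaleR_add_right)
    qed
    then show False using far by (simp add: r_def)
  qed
  obtain f :: "'n option \<Rightarrow> real^'n" and h v where f: "(\<Sum>j\<in>UNIV. f j) = 0" and h: "(\<Sum>j\<in>UNIV. h j) = 1"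
    and f_le: "\<And>j x. x \<in> K' \<Longrightarrow> f j \<bullet> x \<le> h j"
    and v: "\<And>j. v j \<in> unit_ball N" and rv: "r \<le> (\<Sum>j\<in>UNIV. f j \<bullet> v j)"
    by (rule noncovering_functionals[OF K' no]) blast
  have near: "(\<Sum>i\<in>{1..k}. \<Sum>j\<in>UNIV. P i * (h j - f j \<bullet> x i) * (1 - y i \<bullet> (- v j))) \<le> ?\<epsilon>"
  proof -
    \<comment> \<open>the constants \<open>h j\<close> drop out because the \<open>y i\<close> are centred\<close>
    have pair: "n * (\<Sum>i=1..k. P i * (h j - f j \<bullet> x i) * (y i \<bullet> v j)) = - (f j \<bullet> v j)" for j
    proof -
      have "(\<Sum>i=1..k. P i * (h j - f j \<bullet> x i) * (y i \<bullet> v j))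
          = h j * ((\<Sum>i=1..k. P i *\<^sub>R y i) \<bullet> v j) - f j \<bullet> (\<Sum>i=1..k. (P i * (y i \<bullet> v j)) *\<^sub>R x i)"
        by (simp add: inner_sum_left inner_sum_right sum_distrib_left sum_subtractf algebra_simps)
      then have "n * (\<Sum>i=1..k. P i * (h j - f j \<bullet> x i) * (y i \<bullet> v j))
          = - (f j \<bullet> (n *\<^sub>R (\<Sum>i=1..k. (P i * (y i \<bullet> v j)) *\<^sub>R x i)))"
        unfolding y(2) by simp
      then show ?thesis unfolding n(1) id[of "v j", symmetric] .
    qed
    have "(\<Sum>i=1..k. \<Sum>j\<in>UNIV. P i * (h j - f j \<bullet> x i)) = 1"
      by (simp add: sum_distrib_left[symmetric] sum_subtractf h inner_sum_left[symmetric] f P(2)[simplified])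
    then have "(\<Sum>i=1..k. \<Sum>j\<in>UNIV. P i * (h j - f j \<bullet> x i) * (1 - y i \<bullet> (- v j)))
        = 1 + (\<Sum>i=1..k. \<Sum>j\<in>UNIV. P i * (h j - f j \<bullet> x i) * (y i \<bullet> v j))"
      by (simp add: distrib_left sum.distrib)
    also have "(\<Sum>i=1..k. \<Sum>j\<in>UNIV. P i * (h j - f j \<bullet> x i) * (y i \<bullet> v j))
        = (\<Sum>j\<in>UNIV. \<Sum>i=1..k. P i * (h j - f j \<bullet> x i) * (y i \<bullet> v j))" by (rule sum.swap)
    finally have "n * (\<Sum>i=1..k. \<Sum>j\<in>UNIV. P i * (h j - f j \<bullet> x i) * (1 - y i \<bullet> (- v j)))
        = n - (\<Sum>j\<in>UNIV. f j \<bullet> v j)"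
      by (simp only: distrib_left sum_distrib_left[of n _ UNIV] pair) (simp add: sum_negf)
    also have "\<dots> \<le> n * ?\<epsilon>" using rv by (simp add: r_def algebra_simps)
    finally show ?thesis using n(2) by simp
  qed
  interpret E: near_extremal N K' p C \<beta> n "{1..k}" P x y f "\<lambda>j. - v j" h
  proof
    show "n = real DIM(real^'n)" by (simp add: n)
    show "is_norm N" "uniformly_convex p C (dual_norm N)" "C > 0" "p \<ge> 1" "0 < \<beta>" by (fact N uc C p \<beta>(1))+
    show "CARD('n option) = DIM(real^'n) + 1" by simp
    show "convex K'" using K' by (simp add: convex_body_def)
    show "K' \<subseteq> unit_ball N" using sub by (simp add: K'_def)
    show "- v j \<in> unit_ball N" for j using v[of j] by (simp add: unit_ball_def is_norm_simps[OF N])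
  qed (use P x y id f h f_le near n(1) in \<open>auto simp: K'_def\<close>)
  \<comment> \<open>\<open>D \<le> 2 \<beta>\<close> and \<open>n D \<le> 1/2\<close> bound the defect \<open>4 n D / (1 - n D)\<close> of each vertex by \<open>16 n \<beta>\<close>\<close>
  define \<tau> where "\<tau> = 16 * n * \<beta>"
  have D: "E.D \<le> 2 * \<beta>"
  proof -
    have "\<beta>\<^sup>2 \<le> \<beta>" using \<beta>(1) \<beta>20 by (simp add: power2_eq_square mult_left_le)
    then show ?thesis using E.D_le by linarith
  qed
  have n2n4: "n\<^sup>2 * 4 \<le> n ^ 4"
  proof -
    have "n\<^sup>2 * 2\<^sup>2 \<le> n\<^sup>2 * n\<^sup>2" using n(2) by (intro mult_left_mono power_mono) auto
    then show ?thesis by (simp add: power_add[symmetric])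
  qed
  have nn2: "2 * n \<le> n\<^sup>2" using n(2) by (simp add: power2_eq_square)
  have n2\<beta>: "n\<^sup>2 * \<beta> \<le> 1 / 80" using mult_right_mono[OF n2n4 less_imp_le[OF \<beta>(1)]] n4\<beta> by linarith
  have n\<beta>: "n * \<beta> \<le> 1 / 160" using mult_right_mono[OF nn2 less_imp_le[OF \<beta>(1)]] n2\<beta> by linarith
  have nD: "n * E.D \<le> 2 * (n * \<beta>)" using mult_left_mono[OF D, of n] n(2) by simp
  have vertices: "\<exists>z\<in>K'. 1 - \<tau> \<le> h j - f j \<bullet> z" for j
  proof -
    have "n * E.D < 1" using nD n\<beta> by linarith
    then obtain z where z: "z \<in> K'" "(1 - n * E.D) * (1 - E.g j z) \<le> 4 * n * E.D"
      using E.almost_vertex[of j] by blast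
    have "1 - E.g j z \<le> \<tau>"
    proof (cases "1 - E.g j z \<ge> 0")
      case True
      have "(1 / 2) * (1 - E.g j z) \<le> (1 - n * E.D) * (1 - E.g j z)"
        using True nD n\<beta> by (intro mult_right_mono) auto
      then show ?thesis using z(2) nD by (simp add: \<tau>_def)
    next
      case False
      moreover have "0 \<le> \<tau>" using \<beta>(1) n(2) by (simp add: \<tau>_def)
      ultimately show ?thesis by linarith
    qed
    then show ?thesis using z(1) unfolding E.g_def by (intro bexI[of _ z]) linarith+
  qed
  then obtain z where z: "\<And>j. z j \<in> K'" "\<And>j. 1 - \<tau> \<le> h j - f j \<bullet> z j" by metis
  define \<theta> where "\<theta> = (n + 1) * \<tau>"
  have card: "real CARD('n option) * \<tau> = \<theta>" by (simp add: \<theta>_def n(1) algebra_simps)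
  have \<theta>0: "\<theta> > 0" and \<tau>0: "\<tau> \<ge> 0" using \<beta>(1) n(2) by (simp_all add: \<theta>_def \<tau>_def)
  have \<theta>_le: "\<theta> \<le> 24 * n\<^sup>2 * \<beta>"
  proof -
    have "\<theta> = 16 * (n\<^sup>2 * \<beta>) + 8 * ((2 * n) * \<beta>)" by (simp add: \<theta>_def \<tau>_def algebra_simps power2_eq_square)
    also have "\<dots> \<le> 16 * (n\<^sup>2 * \<beta>) + 8 * (n\<^sup>2 * \<beta>)"
      using nn2 \<beta>(1) by (intro add_left_mono mult_left_mono mult_right_mono) auto
    finally show ?thesis by (simp add: mult_ac)
  qed
  have \<theta>2: "\<theta> \<le> 1 / 2" using \<theta>_le n2\<beta> by simp
  obtain \<phi> :: "real^'n \<Rightarrow> real^'n" and d w where \<phi>: "linear \<phi>" "bij \<phi>"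
    and inner: "\<And>x. x \<in> K' \<Longrightarrow> \<phi> x + d \<in> convex hull (range a)"
    and outer: "\<And>s. s \<in> convex hull (range a) \<Longrightarrow> \<exists>x\<in>K'. s = (1 / (1 - \<theta>)) *\<^sub>R \<phi> x + w"
    by (rule simplex_sandwich[OF S E.K(1) f_le f h z \<tau>0, unfolded card]) (use \<theta>2 in auto)
  have "banach_mazur K (convex hull (range a)) \<le> 1 / (1 - \<theta>)"
  proof (rule banach_mazur_le[of "\<phi> \<circ> \<psi>"])
    show "linear (\<phi> \<circ> \<psi>)" by (rule linear_compose[OF \<psi>(1) \<phi>(1)])
    show "bij (\<phi> \<circ> \<psi>)" by (rule bij_comp[OF \<psi>(2) \<phi>(2)])
    show "1 / (1 - \<theta>) > 1" using \<theta>0 \<theta>2 by simp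
    show "(\<phi> \<circ> \<psi>) a' + (\<phi> c + d) \<in> convex hull (range a)" if "a' \<in> K" for a'
      using inner[of "\<psi> a' + c"] that by (simp add: K'_def linear_add[OF \<phi>(1)] add.assoc)
    fix s assume "s \<in> convex hull (range a)"
    then obtain a' where "a' \<in> K" "s = (1 / (1 - \<theta>)) *\<^sub>R \<phi> (\<psi> a' + c) + w" using outer unfolding K'_def by blast
    then show "\<exists>a'\<in>K. s = (1 / (1 - \<theta>)) *\<^sub>R (\<phi> \<circ> \<psi>) a' + ((1 / (1 - \<theta>)) *\<^sub>R \<phi> c + w)"
      by (intro bexI[of _ a']) (simp_all add: linear_add[OF \<phi>(1)] scaleR_add_right)
  qed
  also have "\<dots> \<le> 1 + 2 * \<theta>"
  proof -
    have "\<theta> * (2 * \<theta>) \<le> \<theta> * 1" using \<theta>0 \<theta>2 by (intro mult_left_mono) auto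
    then show ?thesis using \<theta>0 \<theta>2 by (simp add: divide_le_eq algebra_simps)
  qed
  finally show ?thesis using \<theta>_le by simp
qed

theorem corollary6:
  fixes N :: "real ^ 'n \<Rightarrow> real"
    and K S :: "(real ^ 'n) set"
    and n :: nat
    and p C \<epsilon> \<epsilon>\<^sub>0 C\<^sub>0 :: real
  assumes "n = CARD('n)" and "n \<ge> 2"
    and "is_norm N"
    and "convex_body K"
    and "regular_simplex S"
    and "p \<ge> 2" and "C > 0"
    and "uniformly_convex p C (dual_norm N)"
    and "\<epsilon>\<^sub>0 = C / (2 * 40 powr (p + 1) * real n powr (5 * p + 4))"
    and "C\<^sub>0 = 40 * real n ^ 3 * ((2 powr (p + 2) * real n powr (2 * p + 1)) / C) powr (1 / (p + 1))"
    and "0 \<le> \<epsilon>" and "\<epsilon> \<le> \<epsilon>\<^sub>0"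
    and "banach_mazur K (unit_ball N) \<ge> (1 - \<epsilon>) * real n"
  shows "banach_mazur K S \<le> 1 + C\<^sub>0 * \<epsilon> powr (1 / (p + 1))"
proof -
  note asm = assms
  define n' where "n' = real n"
  have n': "n' = real CARD('n)" "n' \<ge> 2" using asm(1,2) by (simp_all add: n'_def)
  define e where "e = 1 / (p + 1)"
  have e: "e > 0" "(p + 1) * e = 1" using asm(6) by (simp_all add: e_def)
  define \<beta> where "\<beta> = (\<epsilon> / C) powr e"
  have \<beta>0: "\<beta> \<ge> 0" by (simp add: \<beta>_def)
  have \<epsilon>_eq: "C * \<beta> powr (p + 1) = \<epsilon>"
    using asm(7,11) e by (simp add: \<beta>_def powr_powr mult.commute)
  obtain V where V: "card V = DIM(real^'n) + 1" "\<not> affine_dependent V" "S = convex hull V"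
    using asm(5) unfolding regular_simplex_def by blast
  have "finite V" using V(1) by (metis card.infinite add_is_0 one_neq_zero)
  then obtain a :: "'n option \<Rightarrow> real^'n" where a: "bij_betw a UNIV V"
    using finite_same_card_bij[of "UNIV :: 'n option set" V] V(1) by auto
  have S_eq: "S = convex hull (range a)" using a V(3) by (simp add: bij_betw_def)
  have S_int: "interior (convex hull (range a)) \<noteq> {}"
    unfolding S_eq[symmetric] V(3) using interior_convex_hull_eq_empty[of V] V(1,2) by simp
  \<comment> \<open>as \<open>5 p + 4 \<ge> 4 (p + 1)\<close>, the threshold on \<open>\<epsilon>\<close> is at most \<open>C * (1 / (40 n ^ 4)) powr (p + 1)\<close>\<close>
  have \<beta>_le: "\<beta> \<le> 1 / (40 * n' ^ 4)"
  proof -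
    have "n' powr (4 * (p + 1)) \<le> n' powr (5 * p + 4)"
      using n'(2) asm(6) by (intro powr_mono) auto
    then have "40 powr (p + 1) * n' powr (4 * (p + 1)) \<le> 2 * 40 powr (p + 1) * n' powr (5 * p + 4)"
      by (simp add: mult_mono)
    also have "40 powr (p + 1) * n' powr (4 * (p + 1)) = (40 * n' powr 4) powr (p + 1)"
      using n'(2) by (simp only: powr_mult powr_powr)
    also have "n' powr 4 = n' ^ 4" using n'(2) by (simp add: powr_numeral)
    finally have *: "(40 * n' ^ 4) powr (p + 1) \<le> 2 * 40 powr (p + 1) * n' powr (5 * p + 4)" .
    have "\<epsilon> / C \<le> 1 / (2 * 40 powr (p + 1) * n' powr (5 * p + 4))"
      using asm(12,7) unfolding asm(9) n'_def[symmetric] by (simp add: field_simps)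
    also have "\<dots> \<le> 1 / (40 * n' ^ 4) powr (p + 1)"
      using * n'(2) by (intro divide_left_mono) auto
    finally have "\<epsilon> / C \<le> (1 / (40 * n' ^ 4)) powr (p + 1)"
      using n'(2) by (simp add: powr_divide)
    then have "\<beta> \<le> ((1 / (40 * n' ^ 4)) powr (p + 1)) powr e"
      unfolding \<beta>_def using asm(7,11) e(1) by (intro powr_mono2) auto
    then show ?thesis using n'(2) e by (simp add: powr_powr)
  qed
  have "1 / (40 * n' ^ 4) < 1 / (20 * n' ^ 4)" using n'(2) by (simp add: divide_strict_left_mono)
  then have \<beta>_less: "\<beta> < 1 / (20 * n' ^ 4)" using \<beta>_le by linarith
  \<comment> \<open>the estimate needs a strict inequality, so \<open>\<beta>\<close> is approached from above; this also covers \<open>\<epsilon> = 0\<close>\<close>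
  have bound: "banach_mazur K S \<le> 1 + 48 * n'\<^sup>2 * b" if b: "\<beta> < b" "b < 1 / (20 * n' ^ 4)" for b
    unfolding S_eq
  proof (rule banach_mazur_simplex_le[OF n' asm(3,4) S_int _ asm(7,8)])
    have "\<beta> powr (p + 1) < b powr (p + 1)" using b \<beta>0 asm(6) by (intro powr_less_mono2) auto
    then have "\<epsilon> < C * b powr (p + 1)" unfolding \<epsilon>_eq[symmetric] using asm(7) by simp
    then have "(1 - C * b powr (p + 1)) * n' < (1 - \<epsilon>) * n'" using n'(2) by (intro mult_strict_right_mono) auto
    then show "(1 - C * b powr (p + 1)) * n' < banach_mazur K (unit_ball N)" using asm(13) by (simp add: n'_def)
  qed (use b \<beta>0 asm(6) in auto)
  \<comment> \<open>let \<open>b\<close> tend to \<open>\<beta>\<close>\<close>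
  have "(banach_mazur K S - 1) / (48 * n'\<^sup>2) \<le> \<beta>"
  proof (rule dense_ge_bounded[OF \<beta>_less])
    fix b assume "\<beta> < b" "b < 1 / (20 * n' ^ 4)"
    from bound[OF this] show "(banach_mazur K S - 1) / (48 * n'\<^sup>2) \<le> b"
      using n'(2) by (simp add: divide_le_eq mult_ac)
  qed
  then have "banach_mazur K S \<le> 1 + 48 * n'\<^sup>2 * \<beta>" using n'(2) by (simp add: divide_le_eq mult_ac)
  also have "\<dots> \<le> 1 + 40 * n' ^ 3 * (2 powr (p + 2) * n' powr (2 * p + 1)) powr e * \<beta>"
  proof (intro add_left_mono mult_right_mono \<beta>0)
    have "1 \<le> (2 powr (p + 2) * n' powr (2 * p + 1)) powr e"
    proof (rule ge_one_powr_ge_zero)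
      have "1 * 1 \<le> 2 powr (p + 2) * n' powr (2 * p + 1)"
        using n'(2) asm(6) by (intro mult_mono ge_one_powr_ge_zero) auto
      then show "1 \<le> 2 powr (p + 2) * n' powr (2 * p + 1)" by simp
    qed (use e(1) in simp)
    moreover have "48 * n'\<^sup>2 \<le> 40 * n' ^ 3"
    proof -
      have "2 * n'\<^sup>2 \<le> n' * n'\<^sup>2" using n'(2) by (intro mult_right_mono) auto
      also have "\<dots> = n' ^ 3" by (simp add: power2_eq_square power3_eq_cube)
      finally show ?thesis using zero_le_power2[of n'] by linarith
    qed
    ultimately show "48 * n'\<^sup>2 \<le> 40 * n' ^ 3 * (2 powr (p + 2) * n' powr (2 * p + 1)) powr e"
      using n'(2) mult_mono[of "48 * n'\<^sup>2" "40 * n' ^ 3" 1 "(2 powr (p + 2) * n' powr (2 * p + 1)) powr e"] by simp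
  qed
  also have "40 * n' ^ 3 * (2 powr (p + 2) * n' powr (2 * p + 1)) powr e * \<beta> = C\<^sub>0 * \<epsilon> powr (1 / (p + 1))"
    using asm(7,11) n'(2) unfolding asm(10) n'_def[symmetric] e_def[symmetric] \<beta>_def
    by (simp add: powr_divide)
  finally show ?thesis by simp
qed

end
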